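(* Let $D$ be a skeletal directed acyclic graph. The canonical complex of $\mathcal{AR}_D$ is isomorphic, as a simplicial complex, to the rope bidiagram complex of $D$.
   Context: All directed graphs are finite and simple. A reorientation of a directed acyclic graph $D=(V,A)$ is a directed graph with the same underlying undirected graph, encoded by the set of arcs of $D$ that it reverses. $\mathcal{AR}_D$ is the poset of acyclic reorientations of $D$ ordered by inclusion of sets of reversed arcs. The transitive reduction of a directed acyclic graph is obtained by deleting all arcs whose endpoints are connected by a directed path of length at least $2$. A directed graph is a forest if its underlying undirected graph has no cycle. $D$ is vertebrate if the transitive reduction of every induced subgraph of $D$ is a forest; filled if for any directed path $\pi$ in $D$ whose endpoints are joined by an arc of $D$, all arcs joining any two vertices of $\pi$ belong to $D$; skeletal if vertebrate and filled. When $D$ is skeletal, $\mathcal{AR}_D$ is a semidistributive lattice, so canonical join and meet representations exist. A join representation of an element $x$ of a finite lattice $L$ is a subset $J\subseteq L$ with $x=\bigvee J$; it is irredundant if $x\ne\bigvee J'$ for every strict subset $J'\subsetneq J$. Irredundant join representations of $x$ are ordered by $J\le J'$ if for any $y\in J$ there is $y'\in J'$ with $y\le y'$. The canonical join representation of $x$ is the minimal irredundant join representation for this order. Canonical meet representations are defined dually. The canonical complex of a semidistributive lattice $L$ is the simplicial complex on the disjoint union of the set of join irreducible elements and the set of meet irreducible elements of $L$, whose faces are the sets $J\sqcup M$ where $J$ is a canonical join representation, $M$ is a canonical meet representation, and $\bigvee J\le\bigwedge M$. The transitive support of an arc $(u,v)$ of $D$ is the set of vertices appearing along directed paths in $D$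 from $u$ to $v$. A rope of $D$ is a quadruple $(u,v,\nabla,\Delta)$ where $(u,v)\in A$ and $\nabla\sqcup\Delta$ is a partition of the transitive support of $(u,v)$ minus $\{u,v\}$. Two ropes $(u,v,\nabla,\Delta)$ and $(u',v',\nabla',\Delta')$ are crossing if there are distinct vertices $w\ne w'$ such that $w\in(\nabla\cup\{u,v\})\cap(\Delta'\cup\{u',v'\})$ and $w'\in(\Delta\cup\{u,v\})\cap(\nabla'\cup\{u',v'\})$. A non-crossing rope diagram is a set of ropes of $D$ any two distinct of which are non-crossing. For ropes $\rho^\vee=(u^\vee,v^\vee,\nabla^\vee,\Delta^\vee)$ and $\rho^\wedge=(u^\wedge,v^\wedge,\nabla^\wedge,\Delta^\wedge)$, write $\rho^\vee\vdash\rho^\wedge$ if there are no $w\in(\Delta^\vee\cup\{u^\vee\})\cap(\nabla^\wedge\cup\{u^\wedge\})$ and $w'\in(\nabla^\vee\cup\{v^\vee\})\cap(\Delta^\wedge\cup\{v^\wedge\})$ such that $(w,w')$ is an arc of $D$. A rope bidiagram of $D$ is a pair $(\delta^\vee,\delta^\wedge)$ of non-crossing rope diagrams of $D$ such that $\rho^\vee\vdash\rho^\wedge$ for all $\rho^\vee\in\delta^\vee$ and $\rho^\wedge\in\delta^\wedge$. The rope bidiagram complex of $D$ is the simplicial complex whose ground set contains two copies $\rho^\vee$ and $\rho^\wedge$ of each rope $\rho$ of $D$, and whose faces are the sets $\{\rho^\vee : \rho\in\delta^\vee\}\sqcup\{\rho^\wedge : \rho\in\delta^\wedge\}$ for all rope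 bidiagrams $(\delta^\vee,\delta^\wedge)$ of $D$. *)

theory Defs
  imports
    "HOL-Algebra.Lattice"
    "Graph_Theory.Graph_Theory"
begin

section \<open>Skeletal directed acyclic graphs\<close>

text \<open>
  \<open>Digraph_Component.forest\<close> forbids directed cycles only, and is never satisfied by a symmetric
  digraph with an arc, where going back and forth along an edge counts as a cycle. A cycle of the
  underlying undirected graph of a loop-free digraph is therefore a cycle of length at least 3 of
  its symmetrization.
\<close>

definition undirected_forest :: "('a, 'b) pre_digraph \<Rightarrow> bool" where
  "undirected_forest G \<longleftrightarrow>
    \<not> (\<exists>p. pre_digraph.cycle (with_proj (mk_symmetric G)) p \<and> length p \<ge> 3)"

definition dipath :: "('a, 'b) pre_digraph \<Rightarrow> 'a \<Rightarrow> 'a list \<Rightarrow> 'a \<Rightarrow> bool" where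
  "dipath G u p v \<longleftrightarrow> vpath p G \<and> hd p = u \<and> last p = v"

definition transitive_reduction :: "('a, 'b) pre_digraph \<Rightarrow> ('a, 'b) pre_digraph" where
  "transitive_reduction G =
    G\<lparr>arcs := {e \<in> arcs G. \<not> (\<exists>p. dipath G (tail G e) p (head G e) \<and> vwalk_length p \<ge> 2)}\<rparr>"

definition vertebrate :: "'a pair_pre_digraph \<Rightarrow> bool" where
  "vertebrate D \<longleftrightarrow>
    (\<forall>S \<subseteq> pverts D. undirected_forest (transitive_reduction (induce_subgraph (with_proj D) S)))"

text \<open>
  In an acyclic digraph, an arc joining two vertices of a directed path is oriented along the path.
\<close>

definition filled :: "'a pair_pre_digraph \<Rightarrow> bool" where
  "filled D \<longleftrightarrow>
    (\<forall>u v p. dipath (with_proj D) u p v \<and> (u, v) \<in> parcs D \<longrightarrow>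
      (\<forall>i j. i < j \<and> j < length p \<longrightarrow> (p ! i, p ! j) \<in> parcs D))"

definition skeletal :: "'a pair_pre_digraph \<Rightarrow> bool" where
  "skeletal D \<longleftrightarrow> vertebrate D \<and> filled D"


section \<open>The poset of acyclic reorientations\<close>

definition reorient :: "'a pair_pre_digraph \<Rightarrow> 'a rel \<Rightarrow> 'a pair_pre_digraph" where
  "reorient D R = D\<lparr>parcs := (parcs D - R) \<union> R\<inverse>\<rparr>"

definition acyclic_reorientation_poset :: "'a pair_pre_digraph \<Rightarrow> 'a rel gorder" where
  "acyclic_reorientation_poset D =
    \<lparr>carrier = {R. R \<subseteq> parcs D \<and> acyclic (parcs (reorient D R))}, eq = (=), le = (\<subseteq>)\<rparr>"


section \<open>Simplicial complexes\<close>

text \<open>A simplicial complex is represented by its ground set and its set of faces.\<close>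

type_synonym 'a complex_on = "'a set \<times> 'a set set"

definition complex_isomorphic :: "'a complex_on \<Rightarrow> 'b complex_on \<Rightarrow> bool" where
  "complex_isomorphic K K' \<longleftrightarrow>
    (\<exists>f. bij_betw f (fst K) (fst K') \<and> (\<lambda>F. f ` F) ` snd K = snd K')"


section \<open>The canonical complex\<close>

text \<open>
  All notions below are meant for a finite lattice \<open>L\<close>. The meet versions are the join versions
  in the dual lattice \<^term>\<open>inv_gorder L\<close>.
\<close>

definition join_irreducible :: "'a gorder \<Rightarrow> 'a \<Rightarrow> bool" where
  "join_irreducible L x \<longleftrightarrow>
    x \<in> carrier L \<and> (\<forall>J \<subseteq> carrier L. x = \<Squnion>\<^bsub>L\<^esub> J \<longrightarrow> x \<in> J)"

definition meet_irreducible :: "'a gorder \<Rightarrow> 'a \<Rightarrow> bool" where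
  "meet_irreducible L x \<longleftrightarrow> join_irreducible (inv_gorder L) x"

definition join_representation :: "'a gorder \<Rightarrow> 'a \<Rightarrow> 'a set \<Rightarrow> bool" where
  "join_representation L x J \<longleftrightarrow> J \<subseteq> carrier L \<and> x = \<Squnion>\<^bsub>L\<^esub> J"

definition irredundant_join_representation :: "'a gorder \<Rightarrow> 'a \<Rightarrow> 'a set \<Rightarrow> bool" where
  "irredundant_join_representation L x J \<longleftrightarrow>
    join_representation L x J \<and> (\<forall>J'. J' \<subset> J \<longrightarrow> x \<noteq> \<Squnion>\<^bsub>L\<^esub> J')"

definition join_refines :: "'a gorder \<Rightarrow> 'a set \<Rightarrow> 'a set \<Rightarrow> bool" where
  "join_refines L J J' \<longleftrightarrow> (\<forall>y \<in> J. \<exists>y' \<in> J'. y \<sqsubseteq>\<^bsub>L\<^esub> y')"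

definition canonical_join_representation :: "'a gorder \<Rightarrow> 'a \<Rightarrow> 'a set \<Rightarrow> bool" where
  "canonical_join_representation L x J \<longleftrightarrow>
    irredundant_join_representation L x J \<and>
    (\<forall>J'. irredundant_join_representation L x J' \<longrightarrow> join_refines L J J')"

definition canonical_meet_representation :: "'a gorder \<Rightarrow> 'a \<Rightarrow> 'a set \<Rightarrow> bool" where
  "canonical_meet_representation L x M \<longleftrightarrow> canonical_join_representation (inv_gorder L) x M"

definition canonical_complex :: "'a gorder \<Rightarrow> ('a + 'a) complex_on" where
  "canonical_complex L =
    ({x. join_irreducible L x} <+> {x. meet_irreducible L x},
     {J <+> M | J M.
        (\<exists>x \<in> carrier L. canonical_join_representation L x J) \<and>
        (\<exists>y \<in> carrier L. canonical_meet_representation L y M) \<and>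
        \<Squnion>\<^bsub>L\<^esub> J \<sqsubseteq>\<^bsub>L\<^esub> \<Sqinter>\<^bsub>L\<^esub> M})"


section \<open>The rope bidiagram complex\<close>

definition transitive_support :: "'a pair_pre_digraph \<Rightarrow> 'a \<Rightarrow> 'a \<Rightarrow> 'a set" where
  "transitive_support D u v = {w. \<exists>p. dipath (with_proj D) u p v \<and> w \<in> set p}"

text \<open>A rope \<open>(u, v, N, U)\<close>, where \<open>N\<close> is the \<open>\<nabla>\<close> part and \<open>U\<close> is the \<open>\<Delta>\<close> part.\<close>

type_synonym 'a rope = "'a \<times> 'a \<times> 'a set \<times> 'a set"

definition ropes :: "'a pair_pre_digraph \<Rightarrow> 'a rope set" where
  "ropes D = {(u, v, N, U). (u, v) \<in> parcs D \<and>
    N \<union> U = transitive_support D u v - {u, v} \<and> N \<inter> U = {}}"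

fun crossing :: "'a rope \<Rightarrow> 'a rope \<Rightarrow> bool" where
  "crossing (u, v, N, U) (u', v', N', U') \<longleftrightarrow>
    (\<exists>w w'. w \<noteq> w' \<and>
      w \<in> (N \<union> {u, v}) \<inter> (U' \<union> {u', v'}) \<and>
      w' \<in> (U \<union> {u, v}) \<inter> (N' \<union> {u', v'}))"

definition noncrossing_rope_diagram :: "'a pair_pre_digraph \<Rightarrow> 'a rope set \<Rightarrow> bool" where
  "noncrossing_rope_diagram D d \<longleftrightarrow>
    d \<subseteq> ropes D \<and> (\<forall>r \<in> d. \<forall>r' \<in> d. r \<noteq> r' \<longrightarrow> \<not> crossing r r')"

text \<open>The relation \<open>r \<turnstile> r'\<close> between a join rope \<open>r\<close> and a meet rope \<open>r'\<close>.\<close>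

fun rope_entails :: "'a pair_pre_digraph \<Rightarrow> 'a rope \<Rightarrow> 'a rope \<Rightarrow> bool" where
  "rope_entails D (u, v, N, U) (u', v', N', U') \<longleftrightarrow>
    \<not> (\<exists>w w'. w \<in> (U \<union> {u}) \<inter> (N' \<union> {u'}) \<and>
        w' \<in> (N \<union> {v}) \<inter> (U' \<union> {v'}) \<and> (w, w') \<in> parcs D)"

definition rope_bidiagram :: "'a pair_pre_digraph \<Rightarrow> 'a rope set \<times> 'a rope set \<Rightarrow> bool" where
  "rope_bidiagram D = (\<lambda>(dj, dm).
    noncrossing_rope_diagram D dj \<and> noncrossing_rope_diagram D dm \<and>
    (\<forall>r \<in> dj. \<forall>r' \<in> dm. rope_entails D r r'))"

definition rope_bidiagram_complex :: "'a pair_pre_digraph \<Rightarrow> ('a rope + 'a rope) complex_on" where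
  "rope_bidiagram_complex D =
    (ropes D <+> ropes D, {dj <+> dm | dj dm. rope_bidiagram D (dj, dm)})"

end

theory Submission
  imports Defs
begin

text \<open>
  In a skeletal digraph, the interior vertices of an arc form with its endpoints a transitive
  tournament, and the underlying graph is chordal. Hence acyclicity of a reorientation is a condition
  on triangles only: the set \<open>R\<close> of reversed arcs must be biclosed. Joins are then transitive closures
  of unions, and \<open>R \<mapsto> A - R\<close> is an antiautomorphism that reduces meets to joins.

  The canonical joinands of \<open>R\<close> correspond to its descents \<open>(u, v)\<close>, the arcs that can be removed from
  \<open>R\<close>: the smallest element below \<open>R\<close> containing \<open>(u, v)\<close> is the join irreducible of the rope whose
  \<open>\<nabla>\<close> and \<open>\<Delta>\<close> parts collect the interior vertices \<open>w\<close> with \<open>(u, w) \<in> R\<close>, respectively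
  \<open>(w, v) \<in> R\<close>. If \<open>J r\<close> and \<open>M r\<close> denote the join and meet irreducible of a rope \<open>r\<close>, then
  \<open>J r \<subseteq> M r'\<close> is exactly \<open>r \<turnstile> r'\<close>, and two ropes are non-crossing iff \<open>J r \<subseteq> M r'\<close> and
  \<open>J r' \<subseteq> M r\<close>.
\<close>

section \<open>Skeletal acyclic digraphs\<close>

lemma set_vwalk_arcs_subset_iff:
  "set (vwalk_arcs p) \<subseteq> B \<longleftrightarrow> successively (\<lambda>x y. (x, y) \<in> B) p"
  by (induction p rule: vwalk_arcs.induct) auto

lemma distinct_if_successively_acyclic:
  assumes "acyclic B" "successively (\<lambda>x y. (x, y) \<in> B) p"
  shows "distinct p"
proof -
  have "successively (\<lambda>x y. (x, y) \<in> B\<^sup>+) p"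
    using assms(2) by (rule successively_mono) auto
  moreover have "transp (\<lambda>x y. (x, y) \<in> B\<^sup>+)"
    by (auto intro: transpI)
  ultimately have "sorted_wrt (\<lambda>x y. (x, y) \<in> B\<^sup>+) p"
    by (simp add: successively_conv_sorted_wrt)
  then have "sorted_wrt (\<noteq>) p"
    by (rule sorted_wrt_mono_rel[rotated]) (use assms(1) in \<open>auto simp: acyclic_def\<close>)
  then show ?thesis
    by (induction p) auto
qed

lemma trancl_imp_successively:
  assumes "(x, y) \<in> B\<^sup>+"
  shows "\<exists>p. p \<noteq> [] \<and> hd p = x \<and> successively (\<lambda>x y. (x, y) \<in> B) p \<and> (last p, y) \<in> B"
  using assms
proof (induction rule: trancl_induct)
  case (base y)
  then show ?case by (intro exI[of _ "[x]"]) auto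
next
  case (step y z)
  then obtain p where "p \<noteq> []" "hd p = x" "successively (\<lambda>x y. (x, y) \<in> B) p" "(last p, y) \<in> B"
    by blast
  with step.hyps(2) show ?case
    by (intro exI[of _ "p @ [y]"]) (auto simp: successively_append_iff)
qed

lemma pcas_zip: "pcas u (zip (u # p) (p @ [v])) v"
  by (induction p arbitrary: u) auto

lemma pawalk_verts_zip: "pawalk_verts u (zip (u # p) (p @ [v])) = u # p @ [v]"
  by (induction p arbitrary: u) auto

lemma set_zip_successively:
  assumes "successively (\<lambda>x y. (x, y) \<in> B) (u # p)" "(last (u # p), v) \<in> B"
  shows "set (zip (u # p) (p @ [v])) \<subseteq> B"
  using assms by (induction p arbitrary: u) auto

definition closed_walk :: "'a rel \<Rightarrow> 'a list \<Rightarrow> bool" where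
  "closed_walk B p \<longleftrightarrow> p \<noteq> [] \<and> successively (\<lambda>x y. (x, y) \<in> B) p \<and> (last p, hd p) \<in> B"

lemma closed_walk_if_not_acyclic:
  assumes "\<not> acyclic B"
  shows "\<exists>p. closed_walk B p"
  using assms trancl_imp_successively[of _ _ B] unfolding acyclic_def closed_walk_def by metis

lemma closed_walk_shortcut:
  assumes "closed_walk B (xs @ a # ys @ b # zs)" "(a, b) \<in> B"
  shows "closed_walk B (xs @ a # b # zs)"
  using assms unfolding closed_walk_def
  by (cases zs; cases xs) (auto simp: successively_append_iff successively_Cons hd_append)

lemma closed_walk_delete:
  assumes "closed_walk B (xs @ a # ys @ a # zs)"
  shows "closed_walk B (xs @ a # zs)"
  using assms unfolding closed_walk_def
  by (cases zs; cases xs) (auto simp: successively_append_iff successively_Cons hd_append)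

lemma closed_walk_inner:
  assumes "closed_walk B (xs @ a # ys @ b # zs)" "(b, a) \<in> B"
  shows "closed_walk B (a # ys @ [b])"
  using assms unfolding closed_walk_def
  by (auto simp: successively_append_iff successively_Cons hd_append)

locale skeletal_dag =
  fixes D :: "'a pair_pre_digraph"
  assumes pair_digraph: "pair_digraph D"
    and acyclic_arcs: "acyclic (parcs D)"
    and skeletal: "skeletal D"
begin

abbreviation A :: "'a rel" where "A \<equiv> parcs D"

lemma finite_arcs: "finite A"
  using pair_digraph pair_fin_digraph.pair_finite_arcs
  by (auto simp: pair_digraph_def)

lemma arc_vertices:
  assumes "(u, v) \<in> A"
  shows "u \<in> pverts D" "v \<in> pverts D"
  using assms pair_digraph
  by (auto simp: pair_digraph_def pair_fin_digraph_def dest: pair_wf_digraph.wellformed')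

lemma arc_irrefl: "(u, u) \<notin> A"
  using acyclic_arcs by (auto simp: acyclic_def)

lemma arc_antisym: "(u, v) \<in> A \<Longrightarrow> (v, u) \<notin> A"
  using acyclic_arcs by (meson acyclic_def r_into_trancl' trancl_into_trancl2)

lemma successively_vertices:
  assumes "successively (\<lambda>x y. (x, y) \<in> A) p" "length p \<ge> 2"
  shows "set p \<subseteq> pverts D"
proof -
  have "set (x # y # ys) \<subseteq> pverts D" if "successively (\<lambda>x y. (x, y) \<in> A) (x # y # ys)" for x y ys
    using that by (induction ys arbitrary: x y) (auto dest: arc_vertices)
  moreover obtain x y ys where "p = x # y # ys"
    using assms(2) by (cases p; cases "tl p") auto
  ultimately show ?thesis using assms by blast
qed

lemma filled_nth:
  assumes "successively (\<lambda>x y. (x, y) \<in> A) p" "(hd p, last p) \<in> A" "i < j" "j < length p"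
  shows "(p ! i, p ! j) \<in> A"
proof -
  have "vwalk p (with_proj D)"
    using assms successively_vertices[of p] by (auto simp: vwalk_def set_vwalk_arcs_subset_iff)
  moreover have "distinct p"
    using assms(1) acyclic_arcs by (rule distinct_if_successively_acyclic[rotated])
  ultimately have "dipath (with_proj D) (hd p) p (last p)"
    by (auto simp: dipath_def vpath_def)
  moreover have "filled D" using skeletal by (simp add: skeletal_def)
  ultimately show ?thesis using assms(2-) unfolding filled_def by blast
qed

lemma arc_of_shortcut:
  assumes "(u, v) \<in> A\<^sup>+" "(v, w) \<in> A\<^sup>+" "(u, w) \<in> A"
  shows "(u, v) \<in> A" "(v, w) \<in> A"
proof -
  obtain p where p: "p \<noteq> []" "hd p = u" "successively (\<lambda>x y. (x, y) \<in> A) p" "(last p, v) \<in> A"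
    using trancl_imp_successively[OF assms(1)] by blast
  obtain q where q: "q \<noteq> []" "hd q = v" "successively (\<lambda>x y. (x, y) \<in> A) q" "(last q, w) \<in> A"
    using trancl_imp_successively[OF assms(2)] by blast
  let ?l = "p @ q @ [w]"
  have l: "successively (\<lambda>x y. (x, y) \<in> A) ?l" "(hd ?l, last ?l) \<in> A"
    using p q assms(3) by (auto simp: successively_append_iff)
  have "?l ! 0 = u" "?l ! length p = v" "?l ! (length p + length q) = w"
    using p(1,2) q(1,2) by (auto simp: nth_append hd_conv_nth)
  moreover have "0 < length p" "0 < length q" using p(1) q(1) by auto
  ultimately show "(u, v) \<in> A" "(v, w) \<in> A"
    using filled_nth[OF l, of 0 "length p"] filled_nth[OF l, of "length p" "length p + length q"]
    by auto
qed

lemma transitive_support_interior: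
  assumes "(u, v) \<in> A"
  shows "transitive_support D u v - {u, v} = {w. (u, w) \<in> A \<and> (w, v) \<in> A}" (is "?S = ?T")
proof
  show "?S \<subseteq> ?T"
  proof
    fix w assume "w \<in> ?S"
    then obtain p where p: "dipath (with_proj D) u p v" "w \<in> set p" "w \<noteq> u" "w \<noteq> v"
      by (auto simp: transitive_support_def)
    then obtain i where i: "i < length p" "w = p ! i" by (auto simp: in_set_conv_nth)
    from p(1) have walk: "successively (\<lambda>x y. (x, y) \<in> A) p" "p \<noteq> []" "p ! 0 = u"
        "p ! (length p - 1) = v" "(hd p, last p) \<in> A"
      using assms by (auto simp: dipath_def vpath_def vwalk_def set_vwalk_arcs_subset_iff
          hd_conv_nth last_conv_nth)
    have "i \<noteq> 0" "i \<noteq> length p - 1"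
      using p(3,4) i walk by metis+
    then show "w \<in> ?T"
      using filled_nth[OF walk(1,5), of 0 i] filled_nth[OF walk(1,5), of i "length p - 1"] i walk
      by auto
  qed
next
  show "?T \<subseteq> ?S"
  proof
    fix w assume w: "w \<in> ?T"
    then have "dipath (with_proj D) u [u, w, v] v"
      using assms arc_irrefl by (auto simp: dipath_def vpath_def vwalk_def dest: arc_vertices)
    then have "w \<in> transitive_support D u v"
      unfolding transitive_support_def
      by (intro CollectI exI[of _ "[u, w, v]"]) auto
    with w show "w \<in> ?S"
      using arc_irrefl by auto
  qed
qed

text \<open>For a filled digraph, the arcs below are those of the transitive reduction of the subgraph
  induced by \<open>S\<close>.\<close>

definition cover_arcs :: "'a set \<Rightarrow> 'a rel" where
  "cover_arcs S = {(a, b) \<in> A. a \<in> S \<and> b \<in> S \<and> \<not> (\<exists>z\<in>S. (a, z) \<in> A \<and> (z, b) \<in> A)}"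

lemma cover_arcs_subset:
  "cover_arcs S \<subseteq> arcs (transitive_reduction (induce_subgraph (with_proj D) S))"
proof (rule subrelI)
  fix a b assume ab: "(a, b) \<in> cover_arcs S"
  let ?I = "induce_subgraph (with_proj D) S"
  have "\<not> (\<exists>p. dipath ?I a p b \<and> vwalk_length p \<ge> 2)"
  proof
    assume "\<exists>p. dipath ?I a p b \<and> vwalk_length p \<ge> 2"
    then obtain p where p: "dipath ?I a p b" "length p \<ge> 3" by auto
    have "arcs_ends ?I \<subseteq> A" by (auto simp: arcs_ends_def arc_to_ends_def)
    then have walk: "successively (\<lambda>x y. (x, y) \<in> A) p" "set p \<subseteq> S" "hd p = a" "last p = b" "p \<noteq> []"
      using p(1) unfolding set_vwalk_arcs_subset_iff[symmetric] by (auto simp: dipath_def vpath_def vwalk_def)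
    have "(p ! 0, p ! 1) \<in> A" "(p ! 1, p ! (length p - 1)) \<in> A"
      using ab walk p(2) by (auto intro!: filled_nth simp: cover_arcs_def)
    moreover have "p ! 1 \<in> S" using walk(2) p(2) by (meson nth_mem order_less_le_trans one_less_numeral_iff semiring_norm(77) subsetD)
    ultimately show False
      using ab walk(3-5) by (auto simp: cover_arcs_def hd_conv_nth last_conv_nth)
  qed
  with ab show "(a, b) \<in> arcs (transitive_reduction ?I)"
    by (auto simp: transitive_reduction_def cover_arcs_def)
qed

lemma no_closed_walk_cover_arcs:
  assumes "S \<subseteq> pverts D" "distinct p" "length p \<ge> 3" "set p \<subseteq> S"
  shows "\<not> closed_walk (cover_arcs S \<union> (cover_arcs S)\<inverse>) p"
proof
  let ?H = "transitive_reduction (induce_subgraph (with_proj D) S)"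
  let ?B = "parcs (mk_symmetric ?H)"
  assume "closed_walk (cover_arcs S \<union> (cover_arcs S)\<inverse>) p"
  moreover have sub: "cover_arcs S \<union> (cover_arcs S)\<inverse> \<subseteq> ?B"
    using cover_arcs_subset[of S]
    by (force simp: parcs_mk_symmetric transitive_reduction_def)
  ultimately have walk: "successively (\<lambda>x y. (x, y) \<in> ?B) p" "(last p, hd p) \<in> ?B"
    unfolding closed_walk_def by (blast intro: successively_mono)+
  obtain u q where p: "p = u # q" using assms(3) by (cases p) auto
  let ?z = "zip (u # q) (q @ [u])"
  have "set ?z \<subseteq> ?B"
    using set_zip_successively[of ?B u q u] walk p by simp
  moreover have "verts ?H = S" by (simp add: transitive_reduction_def)
  ultimately have "pre_digraph.cycle (with_proj (mk_symmetric ?H)) ?z"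
    using assms(2,4) p pcas_zip[of u q u] pawalk_verts_zip[of u q u]
    unfolding pre_digraph.cycle_def pre_digraph.awalk_def
    by (intro exI[of _ u]) (auto simp: cas_with_proj_eq awalk_verts_with_proj_eq simp del: zip.simps pawalk_verts.simps)
  moreover have "length ?z \<ge> 3" using assms(3) p by simp
  moreover have "undirected_forest ?H"
    using skeletal assms(1) unfolding skeletal_def vertebrate_def by blast
  ultimately show False unfolding undirected_forest_def by blast
qed

lemma interval_comparable:
  assumes "(u, v) \<in> A" "(v, w) \<in> A" "(u, x) \<in> A" "(x, w) \<in> A" "(u, w) \<in> A" "v \<noteq> x"
  shows "(v, x) \<in> A \<or> (x, v) \<in> A"
proof (rule ccontr)
  assume nonadj: "\<not> ?thesis"
  let ?S = "{u, v, w, x}"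
  have "closed_walk (cover_arcs ?S \<union> (cover_arcs ?S)\<inverse>) [u, v, w, x]"
    using assms nonadj arc_irrefl arc_antisym unfolding closed_walk_def cover_arcs_def by auto
  moreover have "distinct [u, v, w, x]" using assms arc_irrefl arc_antisym by auto
  ultimately show False
    using no_closed_walk_cover_arcs[of ?S "[u, v, w, x]"] assms by (auto dest: arc_vertices)
qed


end

section \<open>Acyclic reorientations as biclosed sets\<close>

context skeletal_dag
begin

definition biclosed :: "'a rel \<Rightarrow> bool" where
  "biclosed R \<longleftrightarrow> R \<subseteq> A \<and> (\<forall>u v w. (u, v) \<in> A \<longrightarrow> (v, w) \<in> A \<longrightarrow> (u, w) \<in> A \<longrightarrow>
    ((u, v) \<in> R \<longrightarrow> (v, w) \<in> R \<longrightarrow> (u, w) \<in> R) \<and> ((u, w) \<in> R \<longrightarrow> (u, v) \<in> R \<or> (v, w) \<in> R))"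

lemma biclosedI:
  assumes "R \<subseteq> A"
    and "\<And>u v w. \<lbrakk>(u, v) \<in> A; (v, w) \<in> A; (u, w) \<in> A; (u, v) \<in> R; (v, w) \<in> R\<rbrakk> \<Longrightarrow> (u, w) \<in> R"
    and "\<And>u v w. \<lbrakk>(u, v) \<in> A; (v, w) \<in> A; (u, w) \<in> R; (u, v) \<notin> R\<rbrakk> \<Longrightarrow> (v, w) \<in> R"
  shows "biclosed R"
  using assms unfolding biclosed_def by blast

lemma biclosed_subset: "biclosed R \<Longrightarrow> R \<subseteq> A"
  by (simp add: biclosed_def)

lemma biclosed_closed:
  "\<lbrakk>biclosed R; (u, v) \<in> R; (v, w) \<in> R; (u, w) \<in> A\<rbrakk> \<Longrightarrow> (u, w) \<in> R"
  unfolding biclosed_def by blast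

lemma biclosed_coclosed:
  "\<lbrakk>biclosed R; (u, w) \<in> R; (u, v) \<in> A; (v, w) \<in> A\<rbrakk> \<Longrightarrow> (u, v) \<in> R \<or> (v, w) \<in> R"
  unfolding biclosed_def by blast

lemma biclosed_Diff: "biclosed R \<Longrightarrow> biclosed (A - R)"
  unfolding biclosed_def by blast

definition reorientation :: "'a rel \<Rightarrow> 'a rel" where
  "reorientation R = (A - R) \<union> R\<inverse>"

lemma no_directed_triangle: "\<lbrakk>(u, v) \<in> A; (v, w) \<in> A\<rbrakk> \<Longrightarrow> (w, u) \<notin> A"
  using acyclic_arcs by (meson acyclic_def trancl.simps)

lemma biclosed_if_acyclic:
  assumes "R \<subseteq> A" "acyclic (reorientation R)"
  shows "biclosed R"
proof (rule biclosedI[OF assms(1)])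
  have no_triangle: False
    if "(u, v) \<in> reorientation R" "(v, w) \<in> reorientation R" "(w, u) \<in> reorientation R" for u v w
    using that assms(2) by (meson acyclic_def trancl.simps)
  fix u v w
  show "(u, w) \<in> R"
    if "(u, v) \<in> A" "(v, w) \<in> A" "(u, w) \<in> A" "(u, v) \<in> R" "(v, w) \<in> R"
    using that no_triangle[of w v u] by (auto simp: reorientation_def)
  show "(v, w) \<in> R"
    if "(u, v) \<in> A" "(v, w) \<in> A" "(u, w) \<in> R" "(u, v) \<notin> R"
    using that no_triangle[of u v w] by (auto simp: reorientation_def)
qed

text \<open>A shortest directed cycle of the reorientation would be a triangle, which is excluded by
  biclosedness, or chordless, which is excluded by vertebracy.\<close>

lemma acyclic_if_biclosed:
  assumes "biclosed R"
  shows "acyclic (reorientation R)"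
proof (rule ccontr)
  let ?B = "reorientation R"
  assume "\<not> acyclic ?B"
  then obtain p where p: "closed_walk ?B p"
    and minimal: "\<And>q. closed_walk ?B q \<Longrightarrow> length p \<le> length q"
    using closed_walk_if_not_acyclic[of ?B] ex_has_least_nat[of "closed_walk ?B" _ length] by blast
  have RA: "R \<subseteq> A" using assms by (rule biclosed_subset)
  have sub: "(a, b) \<in> A \<or> (b, a) \<in> A" if "(a, b) \<in> ?B" for a b
    using that RA by (auto simp: reorientation_def)
  have total: "(a, b) \<in> ?B \<or> (b, a) \<in> ?B" if "(a, b) \<in> A \<or> (b, a) \<in> A" for a b
    using that by (auto simp: reorientation_def)
  have antisym: "(b, a) \<notin> ?B" if "(a, b) \<in> ?B" for a b
    using that RA arc_antisym by (auto simp: reorientation_def)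
  have forward: "(a, b) \<notin> R" if "(a, b) \<in> ?B" "(a, b) \<in> A" for a b
    using that RA arc_antisym by (auto simp: reorientation_def)
  have backward: "(b, a) \<in> R" if "(a, b) \<in> ?B" "(b, a) \<in> A" for a b
    using that RA arc_antisym by (auto simp: reorientation_def)
  have dist: "distinct p"
  proof (rule ccontr)
    assume "\<not> distinct p"
    then obtain xs y ys zs where p_eq: "p = xs @ y # ys @ y # zs"
      using not_distinct_decomp[of p] by auto
    show False
      using minimal[OF closed_walk_delete[OF p[unfolded p_eq]]] by (simp add: p_eq)
  qed
  have chord: "ys = [] \<or> xs = [] \<and> zs = []"
    if "p = xs @ a # ys @ b # zs" "(a, b) \<in> A \<or> (b, a) \<in> A" for xs a ys b zs
    using total[OF that(2)]
  proof
    assume "(a, b) \<in> ?B"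
    then show ?thesis
      using minimal[OF closed_walk_shortcut[OF p[unfolded that(1)]]] by (simp add: that(1))
  next
    assume "(b, a) \<in> ?B"
    then show ?thesis
      using minimal[OF closed_walk_inner[OF p[unfolded that(1)]]] by (simp add: that(1))
  qed
  have "length p \<noteq> 0" using p by (auto simp: closed_walk_def)
  moreover have "length p \<noteq> 1"
    using p antisym by (fastforce simp: closed_walk_def length_Suc_conv)
  moreover have "length p \<noteq> 2"
    using p antisym by (auto simp: closed_walk_def length_Suc_conv numeral_2_eq_2)
  moreover have "length p \<noteq> 3"
  proof
    assume "length p = 3"
    then obtain a b c where "p = [a, b, c]" by (auto simp: numeral_3_eq_3 length_Suc_conv)
    with p have abc: "(a, b) \<in> ?B" "(b, c) \<in> ?B" "(c, a) \<in> ?B" by (auto simp: closed_walk_def)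
    have along: False if xyz: "(x, y) \<in> ?B" "(y, z) \<in> ?B" "(z, x) \<in> ?B" and "(x, y) \<in> A" "(y, z) \<in> A" for x y z
    proof -
      have "(z, x) \<notin> A" using that(4,5) by (rule no_directed_triangle)
      then have "(x, z) \<in> R" using sub[OF xyz(3)] backward[OF xyz(3)] by blast
      then show False
        using biclosed_coclosed[OF assms, of x z y] that forward by blast
    qed
    have against: False if xyz: "(x, y) \<in> ?B" "(y, z) \<in> ?B" "(z, x) \<in> ?B" and "(y, x) \<in> A" "(z, y) \<in> A" for x y z
    proof -
      have "(x, z) \<notin> A" using that(5,4) by (rule no_directed_triangle)
      then have "(z, x) \<in> A" using sub[OF xyz(3)] by blast
      then show False
        using biclosed_closed[OF assms, of z y x] that forward[OF xyz(3)] backward by blast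
    qed
    show False
      using abc abc[THEN sub] along[of a b c] along[of b c a] along[of c a b]
        against[of a b c] against[of b c a] against[of c a b] by blast
  qed
  ultimately have len: "length p \<ge> 4" by linarith
  let ?adj = "\<lambda>a b. (a, b) \<in> A \<or> (b, a) \<in> A"
  let ?C = "cover_arcs (set p) \<union> (cover_arcs (set p))\<inverse>"
  have cover: "(x, y) \<in> ?C"
    if "(x, y) \<in> ?B" "x \<in> set p" "y \<in> set p" "\<And>z. z \<in> set p \<Longrightarrow> ?adj x z \<Longrightarrow> ?adj z y \<Longrightarrow> False" for x y
    using sub[OF that(1)] that(2-) unfolding cover_arcs_def by blast
  have irrefl: "\<not> ?adj x x" for x using arc_irrefl by blast
  have inner: "(x, y) \<in> ?C" if p_eq: "p = xs @ x # y # zs" for xs x y zs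
  proof (rule cover)
    show "(x, y) \<in> ?B" using p p_eq by (auto simp: closed_walk_def successively_append_iff)
    fix z assume z: "z \<in> set p" "?adj x z" "?adj z y"
    then consider "z \<in> set xs" | "z \<in> set zs" using p_eq irrefl by auto
    then show False
    proof cases
      case 1
      then obtain x1 x2 where "xs = x1 @ z # x2" by (auto simp: in_set_conv_decomp)
      then show False
        using chord[of x1 z "x2 @ [x]" y zs] chord[of x1 z x2 x "y # zs"] p_eq z(2,3) len by auto
    next
      case 2
      then obtain z1 z2 where "zs = z1 @ z # z2" by (auto simp: in_set_conv_decomp)
      then show False
        using chord[of xs x "y # z1" z z2] chord[of "xs @ [x]" y z1 z z2] p_eq z(2,3) len by auto
    qed
  qed (use p_eq in auto)
  have outer: "(last p, hd p) \<in> ?C"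
  proof (rule cover)
    show "(last p, hd p) \<in> ?B" using p by (simp add: closed_walk_def)
    obtain x m y where p_eq: "p = x # m @ [y]"
      using len by (cases p; cases "tl p" rule: rev_cases) auto
    fix z assume z: "z \<in> set p" "?adj (last p) z" "?adj z (hd p)"
    then obtain m1 m2 where "m = m1 @ z # m2"
      using p_eq irrefl by (auto simp: in_set_conv_decomp)
    then show False
      using chord[of "[]" x m1 z "m2 @ [y]"] chord[of "x # m1" z m2 y "[]"] p_eq z(2,3) len by auto
  qed (use p in \<open>auto simp: closed_walk_def\<close>)
  have "successively (\<lambda>x y. (x, y) \<in> ?C) p"
    unfolding successively_conv_nth
  proof (intro allI impI)
    fix i assume "Suc i < length p"
    then have "p = take i p @ p ! i # p ! Suc i # drop (Suc (Suc i)) p"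
      by (simp add: Cons_nth_drop_Suc)
    then show "(p ! i, p ! Suc i) \<in> ?C" by (rule inner)
  qed
  with outer len have "closed_walk ?C p" by (auto simp: closed_walk_def)
  moreover have "set p \<subseteq> pverts D"
  proof
    fix x assume "x \<in> set p"
    then obtain i where "i < length p" "p ! i = x" by (auto simp: in_set_conv_nth)
    moreover have "\<exists>y. ?adj (p ! i) y" if "i < length p" for i
    proof (cases "Suc i < length p")
      case True
      with p have "(p ! i, p ! Suc i) \<in> ?B" by (auto simp: closed_walk_def successively_conv_nth)
      then show ?thesis using sub by blast
    next
      case False
      with that have "length p = Suc i" by simp
      then have "p ! i = last p" by (metis diff_Suc_1 last_conv_nth list.size(3) nat.distinct(1))
      then show ?thesis using p sub by (auto simp: closed_walk_def)
    qed
    ultimately show "x \<in> pverts D" using arc_vertices by blast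
  qed
  ultimately show False
    using no_closed_walk_cover_arcs[of "set p" p] dist len by simp
qed

end

section \<open>Joins and descents\<close>

context skeletal_dag
begin

lemma carrier_acyclic_reorientation_poset:
  "carrier (acyclic_reorientation_poset D) = Collect biclosed"
proof -
  have "parcs (reorient D R) = reorientation R" for R
    by (simp add: reorient_def reorientation_def)
  moreover have "R \<subseteq> A \<and> acyclic (reorientation R) \<longleftrightarrow> biclosed R" for R
    using biclosed_if_acyclic acyclic_if_biclosed biclosed_subset by blast
  ultimately show ?thesis by (simp add: acyclic_reorientation_poset_def)
qed

definition join_closure :: "'a rel set \<Rightarrow> 'a rel" where
  "join_closure F = A \<inter> (\<Union>F)\<^sup>+"

lemma join_closure_upper:
  assumes "S \<in> F" "biclosed S"
  shows "S \<subseteq> join_closure F"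
proof -
  have "S \<subseteq> (\<Union>F)\<^sup>+" using assms(1) by (auto intro: r_into_trancl)
  then show ?thesis using biclosed_subset[OF assms(2)] by (simp add: join_closure_def)
qed

lemma join_closure_least:
  assumes "biclosed T" "\<And>S. S \<in> F \<Longrightarrow> S \<subseteq> T"
  shows "join_closure F \<subseteq> T"
proof -
  have "(u, w) \<in> T" if "(u, w) \<in> (\<Union>F)\<^sup>+" "(u, w) \<in> A" for u w
    using that
  proof (induction rule: converse_trancl_induct)
    case (base y)
    then show ?case using assms by blast
  next
    case (step y z)
    have "\<Union>F \<subseteq> A" using assms biclosed_subset by blast
    with step.hyps have "(y, z) \<in> A" "(z, w) \<in> A\<^sup>+" by (auto intro: trancl_mono)
    then have "(z, w) \<in> A" using step.prems by (auto intro: arc_of_shortcut)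
    with step show ?case using biclosed_closed[OF assms(1), of y z w] assms(2) by blast
  qed
  then show ?thesis unfolding join_closure_def by auto
qed

lemma join_closure_coclosed:
  assumes "\<And>S. S \<in> F \<Longrightarrow> biclosed S"
    and "(u, w) \<in> (\<Union>F)\<^sup>+" "(u, v) \<in> A" "(v, w) \<in> A" "(u, w) \<in> A"
  shows "(u, v) \<in> (\<Union>F)\<^sup>+ \<or> (v, w) \<in> (\<Union>F)\<^sup>+"
  using assms(2-)
proof (induction rule: converse_trancl_induct)
  case (base u)
  then obtain S where "S \<in> F" "(u, w) \<in> S" by blast
  then show ?case using biclosed_coclosed[OF assms(1), of S u w v] base by blast
next
  case (step u x)
  have "\<Union>F \<subseteq> A" using assms(1) biclosed_subset by blast
  with step.hyps have "(u, x) \<in> A" "(x, w) \<in> A\<^sup>+" by (auto intro: trancl_mono)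
  then have xw: "(u, x) \<in> A" "(x, w) \<in> A" using step.prems by (auto intro: arc_of_shortcut)
  consider "x = v" | "(x, v) \<in> A" | "(v, x) \<in> A"
    using interval_comparable[of u v w x] xw step.prems by blast
  then show ?case
  proof cases
    case 1
    then show ?thesis using step.hyps by auto
  next
    case 2
    then show ?thesis using step.IH step.hyps step.prems xw by (meson trancl_into_trancl2)
  next
    case 3
    obtain S where "S \<in> F" "(u, x) \<in> S" using step.hyps(1) by blast
    then have "(u, v) \<in> S \<or> (v, x) \<in> S"
      using biclosed_coclosed[OF assms(1), of S u x v] 3 step.prems by blast
    then show ?thesis
      using \<open>S \<in> F\<close> step.hyps(2) by (meson UnionI r_into_trancl' trancl_into_trancl2)
  qed
qed

lemma biclosed_join_closure:
  assumes "\<And>S. S \<in> F \<Longrightarrow> biclosed S"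
  shows "biclosed (join_closure F)"
proof (rule biclosedI)
  fix u v w
  show "(u, w) \<in> join_closure F"
    if "(u, w) \<in> A" "(u, v) \<in> join_closure F" "(v, w) \<in> join_closure F"
    using that by (auto simp: join_closure_def)
  show "(v, w) \<in> join_closure F"
    if "(u, v) \<in> A" "(v, w) \<in> A" "(u, w) \<in> join_closure F" "(u, v) \<notin> join_closure F"
    using that join_closure_coclosed[OF assms] by (auto simp: join_closure_def)
qed (auto simp: join_closure_def)

definition descents :: "'a rel \<Rightarrow> 'a rel" where
  "descents R = {e \<in> R. biclosed (R - {e})}"

text \<open>The arc below is chosen with the shortest interval between its endpoints in the partial order
  induced by the reorientation. The three triangles that could prevent it from being a descent each
  produce an arc in \<open>R - S\<close> with a shorter interval.\<close>

lemma ex_descent: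
  assumes R: "biclosed R" and S: "biclosed S" and "S \<subset> R"
  shows "\<exists>e \<in> descents R. e \<notin> S"
proof -
  let ?B = "reorientation R"
  let ?I = "\<lambda>e. {x. (snd e, x) \<in> ?B\<^sup>* \<and> (x, fst e) \<in> ?B\<^sup>*}"
  have RA: "R \<subseteq> A" using R by (rule biclosed_subset)
  have cyc: "(x, y) \<in> ?B \<Longrightarrow> (y, x) \<notin> ?B\<^sup>*" for x y
    using acyclic_if_biclosed[OF R] by (meson acyclic_def rtrancl_into_trancl2)
  have "finite ?B"
    using finite_arcs RA by (auto simp: reorientation_def intro: finite_subset)
  then have "finite (insert x (Field ?B))" for x by (simp add: finite_Field)
  moreover have "?I e \<subseteq> insert (snd e) (Field ?B)" for e
    by (auto elim: rtranclE intro: FieldI2)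
  ultimately have fin: "finite (?I e)" for e by (meson finite_subset)
  obtain e where e: "e \<in> R - S" "\<And>e'. e' \<in> R - S \<Longrightarrow> card (?I e) \<le> card (?I e')"
    using ex_has_least_nat[of "\<lambda>e. e \<in> R - S" _ "\<lambda>e. card (?I e)"] \<open>S \<subset> R\<close> by blast
  obtain u v where uv: "e = (u, v)" by (cases e)
  have shorter: "e' \<notin> R - S" if "?I e' \<subset> ?I e" for e'
    using e(2)[of e'] psubset_card_mono[OF fin that] by auto
  have least: "(u, w) \<notin> R - S" "(w, v) \<notin> R - S" if w: "(v, w) \<in> ?B" "(w, u) \<in> ?B" for w
  proof -
    have "v \<in> ?I e - ?I (u, w)" "u \<in> ?I e - ?I (w, v)"
      using w cyc[OF w(1)] cyc[OF w(2)] uv by auto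
    moreover have "?I (u, w) \<subseteq> ?I e" "?I (w, v) \<subseteq> ?I e"
      using w uv by (auto intro: converse_rtrancl_into_rtrancl rtrancl_into_rtrancl)
    ultimately show "(u, w) \<notin> R - S" "(w, v) \<notin> R - S" 
      using shorter[of "(u, w)"] shorter[of "(w, v)"] by blast+
  qed
  have rev: "(b, a) \<in> ?B" if "(a, b) \<in> R" for a b using that by (auto simp: reorientation_def)
  have keep: "(a, b) \<in> ?B" if "(a, b) \<in> A" "(a, b) \<notin> R" for a b
    using that by (auto simp: reorientation_def)
  have "biclosed (R - {(u, v)})"
  proof (rule biclosedI)
    fix a b c
    show "(a, c) \<in> R - {(u, v)}"
      if "(a, c) \<in> A" "(a, b) \<in> R - {(u, v)}" "(b, c) \<in> R - {(u, v)}"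
    proof -
      have "(a, c) \<noteq> (u, v)"
      proof
        assume "(a, c) = (u, v)"
        then have "(u, b) \<in> S" "(b, v) \<in> S"
          using that least[of b] rev by auto
        then show False
          using biclosed_closed[OF S, of u b v] e(1) uv RA by auto
      qed
      then show ?thesis using biclosed_closed[OF R, of a b c] that by blast
    qed
    show "(b, c) \<in> R - {(u, v)}"
      if abc: "(a, b) \<in> A" "(b, c) \<in> A" "(a, c) \<in> R - {(u, v)}" "(a, b) \<notin> R - {(u, v)}"
    proof (cases "(a, b) \<in> R")
      case True
      then have eq: "a = u" "b = v" using abc by auto
      have "(v, c) \<in> R"
      proof (rule ccontr)
        assume "(v, c) \<notin> R"
        then have "(u, c) \<in> S" using abc eq least(1)[of c] rev keep by auto
        then show False
          using biclosed_coclosed[OF S, of u c v] \<open>(v, c) \<notin> R\<close> \<open>S \<subset> R\<close> abc e(1) uv eq by auto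
      qed
      then show ?thesis using eq abc arc_irrefl by auto
    next
      case False
      then have "(b, c) \<in> R" using biclosed_coclosed[OF R, of a c b] abc by auto
      moreover have "(b, c) \<noteq> (u, v)"
      proof
        assume "(b, c) = (u, v)"
        then have eq: "b = u" "c = v" by auto
        then have "(a, v) \<in> S" using abc False least(2)[of a] rev keep by auto
        then show False
          using biclosed_coclosed[OF S, of a v u] False \<open>S \<subset> R\<close> abc e(1) uv eq by auto
      qed
      ultimately show ?thesis by auto
    qed
  qed (use RA in auto)
  then have "e \<in> descents R" using e(1) uv by (auto simp: descents_def)
  with e(1) show ?thesis by auto
qed

end

section \<open>Canonical join representations\<close>

lemma complex_isomorphic_if_inverse_bij:
  assumes g: "bij_betw g (fst K') (fst K)"
    and faces: "(\<lambda>F. g ` F) ` snd K' = snd K" "\<And>F. F \<in> snd K' \<Longrightarrow> F \<subseteq> fst K'"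
  shows "complex_isomorphic K K'"
  unfolding complex_isomorphic_def
proof (intro exI conjI)
  let ?f = "inv_into (fst K') g"
  show "bij_betw ?f (fst K) (fst K')" using g by (rule bij_betw_inv_into)
  have "?f ` g ` F = F" if "F \<in> snd K'" for F
    using bij_betw_imp_inj_on[OF g] faces(2)[OF that] by (rule inv_into_image_cancel)
  then show "(\<lambda>F. ?f ` F) ` snd K = snd K'"
    unfolding faces(1)[symmetric] image_image by simp
qed

locale canonical_joins = partial_order L for L (structure) +
  fixes g :: "'a \<Rightarrow> 'a set"
  assumes ex_sup: "K \<subseteq> carrier L \<Longrightarrow> \<exists>x. least L x (Upper L K)"
    and g_closed: "x \<in> carrier L \<Longrightarrow> g x \<subseteq> carrier L"
    and least_g: "x \<in> carrier L \<Longrightarrow> least L x (Upper L (g x))"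
    and g_refines_least: "x \<in> carrier L \<Longrightarrow> K \<subseteq> carrier L \<Longrightarrow> least L x (Upper L K) \<Longrightarrow>
      join_refines L (g x) K"
    and g_antichain: "x \<in> carrier L \<Longrightarrow> y \<in> g x \<Longrightarrow> z \<in> g x \<Longrightarrow> y \<sqsubseteq> z \<Longrightarrow> y = z"
begin

lemma least_sup: "K \<subseteq> carrier L \<Longrightarrow> least L (\<Squnion>\<^bsub>L\<^esub> K) (Upper L K)"
  unfolding sup_def by (rule someI_ex) (rule ex_sup)

lemma sup_eqI: "K \<subseteq> carrier L \<Longrightarrow> least L x (Upper L K) \<Longrightarrow> \<Squnion>\<^bsub>L\<^esub> K = x"
  using least_sup least_unique eq_is_equal by metis

lemma sup_g: "x \<in> carrier L \<Longrightarrow> \<Squnion>\<^bsub>L\<^esub> g x = x"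
  using least_g g_closed sup_eqI by simp

lemma g_refines: "x \<in> carrier L \<Longrightarrow> K \<subseteq> carrier L \<Longrightarrow> x = \<Squnion>\<^bsub>L\<^esub> K \<Longrightarrow> join_refines L (g x) K"
  using least_sup g_refines_least by simp

lemma sup_closed: "K \<subseteq> carrier L \<Longrightarrow> \<Squnion>\<^bsub>L\<^esub> K \<in> carrier L"
  using least_sup least_closed by blast

lemma sup_upper: "K \<subseteq> carrier L \<Longrightarrow> y \<in> K \<Longrightarrow> y \<sqsubseteq> \<Squnion>\<^bsub>L\<^esub> K"
  using least_sup[of K] by (auto simp: least_def Upper_def)

lemma sup_le_iff:
  assumes "K \<subseteq> carrier L" "x \<in> carrier L"
  shows "\<Squnion>\<^bsub>L\<^esub> K \<sqsubseteq> x \<longleftrightarrow> (\<forall>y\<in>K. y \<sqsubseteq> x)"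
proof
  assume "\<Squnion>\<^bsub>L\<^esub> K \<sqsubseteq> x"
  then show "\<forall>y\<in>K. y \<sqsubseteq> x"
    using assms sup_upper[OF assms(1)] sup_closed[OF assms(1)] by (blast intro: le_trans)
next
  assume "\<forall>y\<in>K. y \<sqsubseteq> x"
  then show "\<Squnion>\<^bsub>L\<^esub> K \<sqsubseteq> x"
    using assms least_sup[OF assms(1)] by (auto simp: least_def Upper_def)
qed

lemma g_subset_if_sup_eq:
  assumes x: "x \<in> carrier L" and K: "K \<subseteq> g x" "x = \<Squnion>\<^bsub>L\<^esub> K"
  shows "K = g x"
proof -
  have "join_refines L (g x) K" using x K g_closed by (intro g_refines) auto
  then have "g x \<subseteq> K" using g_antichain[OF x] K(1) unfolding join_refines_def by blast
  with K(1) show ?thesis by blast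
qed

lemma irredundant_g:
  assumes "x \<in> carrier L"
  shows "irredundant_join_representation L x (g x)"
  unfolding irredundant_join_representation_def join_representation_def
proof (intro conjI allI impI notI)
  show "g x \<subseteq> carrier L" "x = \<Squnion>\<^bsub>L\<^esub> g x" using assms g_closed sup_g by auto
  fix K assume "K \<subset> g x" "x = \<Squnion>\<^bsub>L\<^esub> K"
  then show False using g_subset_if_sup_eq[OF assms, of K] by blast
qed

lemma canonical_join_representation_iff:
  assumes x: "x \<in> carrier L"
  shows "canonical_join_representation L x K \<longleftrightarrow> K = g x"
proof
  assume K: "canonical_join_representation L x K"
  then have rep: "K \<subseteq> carrier L" "x = \<Squnion>\<^bsub>L\<^esub> K" and irr: "\<And>K'. K' \<subset> K \<Longrightarrow> x \<noteq> \<Squnion>\<^bsub>L\<^esub> K'"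
    by (auto simp: canonical_join_representation_def irredundant_join_representation_def
        join_representation_def)
  have K_refines: "join_refines L K (g x)"
    using K irredundant_g[OF x] by (auto simp: canonical_join_representation_def)
  have "join_refines L (g x) K" using g_refines x rep by blast
  have squeeze: "y = z" if "y \<in> g x" "z \<in> K" "y' \<in> g x" "y \<sqsubseteq> z" "z \<sqsubseteq> y'" for y z y'
  proof -
    have c: "y \<in> carrier L" "z \<in> carrier L" "y' \<in> carrier L"
      using that g_closed[OF x] rep(1) by auto
    then have "y \<sqsubseteq> y'" using that(4,5) by (blast intro: le_trans)
    then have "y = y'" using g_antichain[OF x] that by blast
    then show ?thesis using that c by (blast intro: le_antisym)
  qed
  have "g x \<subseteq> K"
  proof
    fix y assume y: "y \<in> g x"
    then obtain z where z: "z \<in> K" "y \<sqsubseteq> z"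
      using \<open>join_refines L (g x) K\<close> unfolding join_refines_def by blast
    then obtain y' where "y' \<in> g x" "z \<sqsubseteq> y'"
      using K_refines unfolding join_refines_def by blast
    with squeeze[OF y z(1)] z show "y \<in> K" by blast
  qed
  then show "K = g x" using irr[of "g x"] sup_g[OF x] by (metis psubsetI)
next
  assume "K = g x"
  then show "canonical_join_representation L x K"
    using irredundant_g[OF x] g_refines[OF x]
    by (auto simp: canonical_join_representation_def irredundant_join_representation_def
        join_representation_def)
qed

lemma join_irreducible_iff: "join_irreducible L x \<longleftrightarrow> x \<in> carrier L \<and> x \<in> g x"
proof
  assume "join_irreducible L x"
  then show "x \<in> carrier L \<and> x \<in> g x"
    using g_closed sup_g unfolding join_irreducible_def by metis
next
  assume x: "x \<in> carrier L \<and> x \<in> g x"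
  have "x \<in> K" if K: "K \<subseteq> carrier L" "x = \<Squnion>\<^bsub>L\<^esub> K" for K
  proof -
    obtain y where "y \<in> K" "x \<sqsubseteq> y" using g_refines[of x K] x K by (auto simp: join_refines_def)
    moreover have "y \<sqsubseteq> x" using sup_upper[OF K(1)] K(2) \<open>y \<in> K\<close> by simp
    ultimately show ?thesis using x K(1) by (metis le_antisym subsetD)
  qed
  with x show "join_irreducible L x" by (auto simp: join_irreducible_def)
qed

end

section \<open>Ropes\<close>

context skeletal_dag
begin

text \<open>\<open>join_arcs r\<close> is the join irreducible and \<open>meet_arcs r\<close> the meet irreducible of the rope \<open>r\<close>.\<close>

fun join_arcs :: "'a rope \<Rightarrow> 'a rel" where
  "join_arcs (u, v, N, U) = {(a, b) \<in> A. a \<in> insert u U \<and> b \<in> insert v N}"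

fun meet_arcs :: "'a rope \<Rightarrow> 'a rel" where
  "meet_arcs (u, v, N, U) = A - {(a, b) \<in> A. a \<in> insert u N \<and> b \<in> insert v U}"

fun flip :: "'a rope \<Rightarrow> 'a rope" where
  "flip (u, v, N, U) = (u, v, U, N)"

fun ends :: "'a rope \<Rightarrow> 'a \<times> 'a" where
  "ends (u, v, N, U) = (u, v)"

fun descent_rope :: "'a rel \<Rightarrow> 'a \<times> 'a \<Rightarrow> 'a rope" where
  "descent_rope R (u, v) =
    (u, v, {w. (u, w) \<in> R \<and> (w, v) \<in> A}, {w. (u, w) \<in> A \<and> (w, v) \<in> R})"

lemma mem_ropes_iff:
  "(u, v, N, U) \<in> ropes D \<longleftrightarrow>
    (u, v) \<in> A \<and> N \<union> U = {w. (u, w) \<in> A \<and> (w, v) \<in> A} \<and> N \<inter> U = {}"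
  using transitive_support_interior unfolding ropes_def by auto

lemma meet_arcs_conv_join_arcs: "meet_arcs r = A - join_arcs (flip r)"
  by (cases r) auto

lemma flip_flip [simp]: "flip (flip r) = r"
  by (cases r) auto

lemma flip_mem_ropes_iff [simp]: "flip r \<in> ropes D \<longleftrightarrow> r \<in> ropes D"
  by (cases r) (auto simp: mem_ropes_iff)

lemma join_arcs_subset: "join_arcs r \<subseteq> A"
  by (cases r) auto

lemma ends_descent_rope [simp]: "ends (descent_rope R e) = e"
  by (cases e) auto

lemma ends_mem_join_arcs: "r \<in> ropes D \<Longrightarrow> ends r \<in> join_arcs r"
  by (cases r) (auto simp: mem_ropes_iff)

lemma rope_entails_iff: "rope_entails D r r' \<longleftrightarrow> join_arcs r \<subseteq> meet_arcs r'"
  by (cases r; cases r') auto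

lemma crossing_flip: "crossing (flip r) (flip r') \<longleftrightarrow> crossing r r'"
  by (cases r; cases r') (simp only: flip.simps crossing.simps, metis)

lemma interval_adjacent:
  assumes "(u, v) \<in> A" "a \<noteq> b"
    and "a \<in> {u, v} \<or> (u, a) \<in> A \<and> (a, v) \<in> A" "b \<in> {u, v} \<or> (u, b) \<in> A \<and> (b, v) \<in> A"
  shows "(a, b) \<in> A \<or> (b, a) \<in> A"
  using assms interval_comparable[of u a v b] by auto

lemma crossing_iff:
  assumes "r \<in> ropes D" "r' \<in> ropes D"
  shows "crossing r r' \<longleftrightarrow> \<not> join_arcs r \<subseteq> meet_arcs r' \<or> \<not> join_arcs r' \<subseteq> meet_arcs r"
proof -
  obtain u v N U where r: "r = (u, v, N, U)" by (cases r)
  obtain u' v' N' U' where r': "r' = (u', v', N', U')" by (cases r')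
  have arcs: "(u, v) \<in> A" "N \<union> U = {w. (u, w) \<in> A \<and> (w, v) \<in> A}"
    "(u', v') \<in> A" "N' \<union> U' = {w. (u', w) \<in> A \<and> (w, v') \<in> A}"
    using assms by (auto simp: r r' mem_ropes_iff)
  show ?thesis
  proof
    assume "crossing r r'"
    then obtain w w' where ww': "w \<noteq> w'" "w \<in> (N \<union> {u, v}) \<inter> (U' \<union> {u', v'})"
      "w' \<in> (U \<union> {u, v}) \<inter> (N' \<union> {u', v'})"
      by (auto simp: r r')
    have no_arc: "(x, u) \<notin> A" "(v, x) \<notin> A" if "x \<in> N \<union> U \<union> {u, v}" for x
      using that arcs(1,2) arc_antisym arc_irrefl by blast+
    have no_arc': "(x, u') \<notin> A" "(v', x) \<notin> A" if "x \<in> N' \<union> U' \<union> {u', v'}" for x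
      using that arcs(3,4) arc_antisym arc_irrefl by blast+
    have support: "w \<in> N \<union> U \<union> {u, v}" "w' \<in> N \<union> U \<union> {u, v}"
      "w \<in> N' \<union> U' \<union> {u', v'}" "w' \<in> N' \<union> U' \<union> {u', v'}"
      using ww' by auto
    note ne = no_arc[OF support(1)] no_arc[OF support(2)] no_arc'[OF support(3)] no_arc'[OF support(4)]
    from ww' have "(w, w') \<in> A \<or> (w', w) \<in> A"
      using arcs by (intro interval_adjacent[of u v]) auto
    then show "\<not> join_arcs r \<subseteq> meet_arcs r' \<or> \<not> join_arcs r' \<subseteq> meet_arcs r"
    proof
      assume "(w, w') \<in> A"
      then have "w \<noteq> v" "w \<noteq> v'" "w' \<noteq> u" "w' \<noteq> u'"
        using ne by auto
      then have "(w, w') \<in> join_arcs r' - meet_arcs r" using \<open>(w, w') \<in> A\<close> ww' by (auto simp: r r')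
      then show ?thesis by blast
    next
      assume "(w', w) \<in> A"
      then have "w' \<noteq> v" "w' \<noteq> v'" "w \<noteq> u" "w \<noteq> u'"
        using ne by auto
      then have "(w', w) \<in> join_arcs r - meet_arcs r'" using \<open>(w', w) \<in> A\<close> ww' by (auto simp: r r')
      then show ?thesis by blast
    qed
  next
    assume "\<not> join_arcs r \<subseteq> meet_arcs r' \<or> \<not> join_arcs r' \<subseteq> meet_arcs r"
    then show "crossing r r'"
    proof
      assume "\<not> join_arcs r \<subseteq> meet_arcs r'"
      then obtain w w' where "(w, w') \<in> A" "w \<in> insert u U" "w \<in> insert u' N'"
        "w' \<in> insert v N" "w' \<in> insert v' U'"
        by (auto simp only: r r' join_arcs.simps meet_arcs.simps)
      moreover from this(1) have "w' \<noteq> w" using arc_irrefl by auto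
      ultimately show ?thesis
        unfolding r r' crossing.simps by - (rule exI[of _ w'], rule exI[of _ w], auto)
    next
      assume "\<not> join_arcs r' \<subseteq> meet_arcs r"
      then obtain w w' where "(w, w') \<in> A" "w \<in> insert u' U'" "w \<in> insert u N"
        "w' \<in> insert v' N'" "w' \<in> insert v U"
        by (auto simp only: r r' join_arcs.simps meet_arcs.simps)
      moreover from this(1) have "w \<noteq> w'" using arc_irrefl by auto
      ultimately show ?thesis
        unfolding r r' crossing.simps by - (rule exI[of _ w], rule exI[of _ w'], auto)
    qed
  qed
qed

lemma biclosed_join_arcs:
  assumes "r \<in> ropes D"
  shows "biclosed (join_arcs r)"
proof (rule biclosedI[OF join_arcs_subset])
  obtain u v N U where r: "r = (u, v, N, U)" by (cases r)
  have rope: "(u, v) \<in> A" "N \<union> U = {w. (u, w) \<in> A \<and> (w, v) \<in> A}" "N \<inter> U = {}"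
    using assms by (auto simp: r mem_ropes_iff)
  fix a b c
  show "(a, c) \<in> join_arcs r" if "(a, b) \<in> join_arcs r" "(b, c) \<in> join_arcs r"
  proof -
    have "b \<in> insert v N \<inter> insert u U" using that by (auto simp: r)
    moreover have "u \<notin> N" "v \<notin> U" "u \<noteq> v" using rope arc_irrefl by auto
    ultimately show ?thesis using rope(3) by auto
  qed
  show "(b, c) \<in> join_arcs r"
    if abc: "(a, b) \<in> A" "(b, c) \<in> A" "(a, c) \<in> join_arcs r" "(a, b) \<notin> join_arcs r"
  proof -
    have a: "a \<in> insert u U" and c: "c \<in> insert v N" using abc(3) by (auto simp: r)
    have "(u, b) \<in> A\<^sup>+" "(b, v) \<in> A\<^sup>+"
      using a c rope(2) abc(1,2) by (auto intro: trancl_into_trancl)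
    then have "b \<in> N \<union> U" using rope(1,2) arc_of_shortcut by blast
    then show ?thesis using abc a c by (auto simp: r)
  qed
qed

lemma biclosed_meet_arcs: "r \<in> ropes D \<Longrightarrow> biclosed (meet_arcs r)"
  by (simp add: meet_arcs_conv_join_arcs biclosed_Diff biclosed_join_arcs)

lemma descent_arc: "\<lbrakk>biclosed R; (u, v) \<in> descents R\<rbrakk> \<Longrightarrow> (u, v) \<in> A"
  by (auto simp: descents_def dest: biclosed_subset)

lemma descent_not_composite:
  assumes "biclosed R" "(u, v) \<in> descents R" "(u, w) \<in> R"
  shows "(w, v) \<notin> R"
proof
  assume "(w, v) \<in> R"
  moreover have "w \<noteq> u" "w \<noteq> v"
    using assms(1,3) \<open>(w, v) \<in> R\<close> biclosed_subset arc_irrefl by blast+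
  ultimately show False
    using assms biclosed_closed[of "R - {(u, v)}" u w v] descent_arc[OF assms(1,2)]
    by (auto simp: descents_def)
qed

lemma descent_rope_in_ropes:
  assumes R: "biclosed R" and "e \<in> descents R"
  shows "descent_rope R e \<in> ropes D"
proof -
  obtain u v where e: "e = (u, v)" by (cases e)
  then have uv: "(u, v) \<in> descents R" "(u, v) \<in> R" using assms by (auto simp: descents_def)
  have "R \<subseteq> A" using R by (rule biclosed_subset)
  then show ?thesis
    using descent_arc[OF R uv(1)] descent_not_composite[OF R uv(1)] biclosed_coclosed[OF R uv(2)]
    by (auto simp: e mem_ropes_iff)
qed

text \<open>Below \<open>R\<close>, the arcs from \<open>u\<close> and to \<open>v\<close> of an element containing the descent \<open>(u, v)\<close> are
  forced by coclosedness; above \<open>R - {(u, v)}\<close> they are forced by closedness.\<close>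

lemma join_arcs_descent_rope_subset:
  assumes R: "biclosed R" and e: "e \<in> descents R" and S: "biclosed S" "S \<subseteq> R" "e \<in> S"
  shows "join_arcs (descent_rope R e) \<subseteq> S"
proof (rule subrelI)
  obtain u v where uv: "e = (u, v)" by (cases e)
  note not_composite = descent_not_composite[OF R e[unfolded uv]]
  have N: "(u, b) \<in> S" if "(u, b) \<in> R" "(b, v) \<in> A" for b
    using biclosed_coclosed[OF S(1), of u v b] not_composite[OF that(1)] that S(2,3)
      biclosed_subset[OF R] uv by blast
  have U: "(a, v) \<in> S" "(u, a) \<notin> R" if "(u, a) \<in> A" "(a, v) \<in> R" for a
    using biclosed_coclosed[OF S(1), of u v a] not_composite[of a] that S(2,3)
      biclosed_subset[OF R] uv by blast+
  fix a b assume "(a, b) \<in> join_arcs (descent_rope R e)"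
  then have ab: "(a, b) \<in> A" "a = u \<or> (u, a) \<in> A \<and> (a, v) \<in> R" "b = v \<or> (u, b) \<in> R \<and> (b, v) \<in> A"
    by (auto simp: uv)
  show "(a, b) \<in> S"
  proof (cases "a = u \<or> b = v")
    case True
    then show ?thesis using ab N U S(3) uv by blast
  next
    case False
    then have "(u, b) \<in> S" "(u, a) \<in> A" "(u, a) \<notin> S" using ab N U S(2) by blast+
    then show ?thesis using biclosed_coclosed[OF S(1), of u b a] ab(1) by blast
  qed
qed

lemma subset_meet_arcs_descent_rope:
  assumes R: "biclosed R" and e: "e \<in> descents R"
  shows "R - {e} \<subseteq> meet_arcs (descent_rope R e)"
proof (rule subrelI)
  obtain u v where uv: "e = (u, v)" by (cases e)
  note not_composite = descent_not_composite[OF R e[unfolded uv]]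
  fix a b assume ab: "(a, b) \<in> R - {e}"
  have "\<not> (a \<in> insert u {w. (u, w) \<in> R \<and> (w, v) \<in> A} \<and> b \<in> insert v {w. (u, w) \<in> A \<and> (w, v) \<in> R})"
    using ab not_composite biclosed_closed[OF R, of u a b] uv by blast
  then show "(a, b) \<in> meet_arcs (descent_rope R e)"
    using ab biclosed_subset[OF R] by (auto simp: uv)
qed

definition canonical_joinands :: "'a rel \<Rightarrow> 'a rel set" where
  "canonical_joinands R = join_arcs ` descent_rope R ` descents R"

lemma biclosed_canonical_joinands:
  assumes "biclosed R" "S \<in> canonical_joinands R"
  shows "biclosed S"
proof -
  obtain e where "e \<in> descents R" "S = join_arcs (descent_rope R e)"
    using assms(2) by (auto simp: canonical_joinands_def)
  then show ?thesis using assms(1) by (simp add: biclosed_join_arcs descent_rope_in_ropes)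
qed

lemma descent_mem_join_arcs:
  assumes "biclosed R" "e \<in> descents R"
  shows "e \<in> join_arcs (descent_rope R e)"
  using ends_mem_join_arcs[OF descent_rope_in_ropes[OF assms]] by simp

lemma join_closure_canonical_joinands:
  assumes R: "biclosed R"
  shows "join_closure (canonical_joinands R) = R"
proof (rule ccontr)
  let ?S = "join_closure (canonical_joinands R)"
  assume "?S \<noteq> R"
  moreover have "?S \<subseteq> R"
  proof (rule join_closure_least[OF R])
    fix S assume "S \<in> canonical_joinands R"
    then obtain e where e: "e \<in> descents R" "S = join_arcs (descent_rope R e)"
      by (auto simp: canonical_joinands_def)
    moreover from e have "e \<in> R" by (simp add: descents_def)
    ultimately show "S \<subseteq> R"
      using join_arcs_descent_rope_subset[OF R _ R subset_refl] by blast
  qed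
  moreover have "biclosed ?S" using biclosed_canonical_joinands[OF R] by (rule biclosed_join_closure)
  ultimately obtain e where e: "e \<in> descents R" "e \<notin> ?S" using ex_descent[OF R] by blast
  have "join_arcs (descent_rope R e) \<subseteq> ?S"
    using R e(1) by (intro join_closure_upper biclosed_join_arcs descent_rope_in_ropes)
      (auto simp: canonical_joinands_def)
  with e descent_mem_join_arcs[OF R] show False by blast
qed

lemma descent_mem_joinand:
  assumes "\<And>S. S \<in> K \<Longrightarrow> biclosed S" and R: "biclosed R" "R = join_closure K" and e: "e \<in> descents R"
  shows "\<exists>S\<in>K. e \<in> S"
proof (rule ccontr)
  assume none: "\<not> (\<exists>S\<in>K. e \<in> S)"
  have "R \<subseteq> R - {e}"
    unfolding R(2)
  proof (rule join_closure_least)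
    show "biclosed (join_closure K - {e})" using e by (simp add: descents_def R(2))
    show "S \<subseteq> join_closure K - {e}" if "S \<in> K" for S
      using that none join_closure_upper[of S K] assms(1) by blast
  qed
  with e show False by (auto simp: descents_def)
qed

lemma canonical_joinands_refine:
  assumes K: "\<And>S. S \<in> K \<Longrightarrow> biclosed S" and R: "biclosed R" "R = join_closure K"
    and T: "T \<in> canonical_joinands R"
  shows "\<exists>S\<in>K. T \<subseteq> S"
proof -
  obtain e where e: "e \<in> descents R" "T = join_arcs (descent_rope R e)"
    using T by (auto simp: canonical_joinands_def)
  obtain S where S: "S \<in> K" "e \<in> S" using descent_mem_joinand[OF K R e(1)] by blast
  have "S \<subseteq> R" unfolding R(2) using S(1) K by (intro join_closure_upper)
  then have "T \<subseteq> S"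
    using join_arcs_descent_rope_subset[OF R(1) e(1) K[OF S(1)]] S(2) e(2) by blast
  with S(1) show ?thesis ..
qed

lemma descent_mem_join_arcs_eq:
  assumes R: "biclosed R" and "e \<in> descents R" "e' \<in> descents R"
    and "e \<in> join_arcs (descent_rope R e')"
  shows "e = e'"
proof (rule ccontr)
  assume "e \<noteq> e'"
  then have "join_arcs (descent_rope R e') \<subseteq> R - {e}"
    using assms by (intro join_arcs_descent_rope_subset) (auto simp: descents_def)
  with assms(4) show False by blast
qed

lemma canonical_joinands_antichain:
  assumes R: "biclosed R" and "S \<in> canonical_joinands R" "T \<in> canonical_joinands R" "S \<subseteq> T"
  shows "S = T"
proof -
  obtain e e' where "e \<in> descents R" "S = join_arcs (descent_rope R e)"
    "e' \<in> descents R" "T = join_arcs (descent_rope R e')"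
    using assms(2,3) by (auto simp: canonical_joinands_def)
  then show ?thesis
    using descent_mem_join_arcs_eq[OF R, of e e'] descent_mem_join_arcs[OF R, of e] assms(4) by blast
qed

lemma noncrossing_descent_ropes:
  assumes R: "biclosed R"
  shows "noncrossing_rope_diagram D (descent_rope R ` descents R)"
proof -
  have "join_arcs (descent_rope R e) \<subseteq> meet_arcs (descent_rope R e')"
    if "e \<in> descents R" "e' \<in> descents R" "e \<noteq> e'" for e e'
  proof -
    have "join_arcs (descent_rope R e) \<subseteq> R - {e'}"
      using that R by (intro join_arcs_descent_rope_subset) (auto simp: descents_def)
    also have "\<dots> \<subseteq> meet_arcs (descent_rope R e')"
      using R that(2) by (rule subset_meet_arcs_descent_rope)
    finally show ?thesis .
  qed
  then have "\<not> crossing (descent_rope R e) (descent_rope R e')"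
    if "e \<in> descents R" "e' \<in> descents R" "e \<noteq> e'" for e e'
    using that descent_rope_in_ropes[OF R] crossing_iff by presburger
  then show ?thesis
    using descent_rope_in_ropes[OF R] unfolding noncrossing_rope_diagram_def by blast
qed

lemma biclosed_join_arcs_Diff_ends:
  assumes "r \<in> ropes D"
  shows "biclosed (join_arcs r - {ends r})"
proof (rule biclosedI)
  have J: "biclosed (join_arcs r)" using assms by (rule biclosed_join_arcs)
  obtain u v N U where r: "r = (u, v, N, U)" by (cases r)
  have rope: "(u, v) \<in> A" "N \<union> U = {w. (u, w) \<in> A \<and> (w, v) \<in> A}" "N \<inter> U = {}"
    using assms by (auto simp: r mem_ropes_iff)
  show "join_arcs r - {ends r} \<subseteq> A" using join_arcs_subset by blast
  fix a b c
  show "(a, c) \<in> join_arcs r - {ends r}"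
    if "(a, b) \<in> join_arcs r - {ends r}" "(b, c) \<in> join_arcs r - {ends r}"
  proof -
    have "b \<in> insert v N \<inter> insert u U" using that by (auto simp: r)
    moreover have "u \<notin> N" "v \<notin> U" "u \<noteq> v" using rope arc_irrefl by auto
    ultimately show ?thesis using rope(3) by auto
  qed
  show "(b, c) \<in> join_arcs r - {ends r}"
    if abc: "(a, b) \<in> A" "(b, c) \<in> A" "(a, c) \<in> join_arcs r - {ends r}"
      "(a, b) \<notin> join_arcs r - {ends r}"
  proof -
    have a: "a = u \<or> (u, a) \<in> A" and c: "c = v \<or> (c, v) \<in> A"
      using abc(3) rope by (auto simp: r)
    have "(a, b) \<noteq> (u, v)" "(b, c) \<noteq> (u, v)"
      using a c abc(1,2) arc_antisym arc_irrefl by auto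
    then show ?thesis using biclosed_coclosed[OF J, of a c b] abc by (auto simp: r)
  qed
qed

lemma join_arcs_subset_meet_arcs_ends:
  assumes "r \<in> ropes D"
  shows "join_arcs r - {ends r} \<subseteq> meet_arcs r"
  using assms arc_irrefl by (cases r) (auto simp: mem_ropes_iff)

lemma biclosed_insert_ends_meet_arcs:
  assumes "r \<in> ropes D"
  shows "biclosed (insert (ends r) (meet_arcs r))"
proof -
  have "ends r \<in> A" using ends_mem_join_arcs[OF assms] join_arcs_subset by blast
  then have "insert (ends r) (meet_arcs r) = A - (join_arcs (flip r) - {ends (flip r)})"
    by (cases r) (auto simp: meet_arcs_conv_join_arcs)
  then show ?thesis using assms by (simp add: biclosed_Diff biclosed_join_arcs_Diff_ends)
qed

lemma ends_notin_meet_arcs: "r \<in> ropes D \<Longrightarrow> ends r \<notin> meet_arcs r"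
  by (cases r) (auto simp: mem_ropes_iff)

lemma descents_join_closure:
  assumes d: "noncrossing_rope_diagram D d"
  defines "R \<equiv> join_closure (join_arcs ` d)"
  shows "descents R = ends ` d" and "descent_rope R ` descents R = d"
proof -
  have R_eq: "R = join_closure (join_arcs ` d)" by (simp add: R_def)
  have ropes: "r \<in> ropes D" if "r \<in> d" for r
    using d that by (auto simp: noncrossing_rope_diagram_def)
  have noncrossing: "join_arcs r' \<subseteq> meet_arcs r" if "r \<in> d" "r' \<in> d" "r \<noteq> r'" for r r'
    using d that ropes by (auto simp: noncrossing_rope_diagram_def crossing_iff)
  have biclosed_K: "biclosed S" if "S \<in> join_arcs ` d" for S
    using that ropes biclosed_join_arcs by auto
  have R: "biclosed R" unfolding R_def using biclosed_K by (rule biclosed_join_closure)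
  have le_R: "join_arcs r \<subseteq> R" if "r \<in> d" for r
    unfolding R_def using that biclosed_K by (intro join_closure_upper) auto
  have le_insert: "R \<subseteq> insert (ends r) (meet_arcs r)" if "r \<in> d" for r
    unfolding R_def using that ropes noncrossing join_arcs_subset_meet_arcs_ends
    by (intro join_closure_least biclosed_insert_ends_meet_arcs) blast+
  have rope_eq: "descent_rope R (ends r) = r" if "r \<in> d" for r
  proof -
    obtain u v N U where r: "r = (u, v, N, U)" by (cases r)
    have rope: "(u, v) \<in> A" "N \<union> U = {w. (u, w) \<in> A \<and> (w, v) \<in> A}" "N \<inter> U = {}"
      using ropes[OF that] by (auto simp: r mem_ropes_iff)
    have "(u, w) \<in> R" "(w, v) \<notin> R" if w: "w \<in> N" for w
    proof -
      have uw: "(u, w) \<in> A" "(w, v) \<in> A" "w \<noteq> u" using rope(2) w arc_irrefl by auto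
      then have "(u, w) \<in> join_arcs r" using w by (simp add: r)
      then show "(u, w) \<in> R" using le_R[OF \<open>r \<in> d\<close>] by blast
      have "(w, v) \<notin> insert (ends r) (meet_arcs r)" using uw w by (simp add: r)
      then show "(w, v) \<notin> R" using le_insert[OF \<open>r \<in> d\<close>] by blast
    qed
    moreover have "(w, v) \<in> R" "(u, w) \<notin> R" if w: "w \<in> U" for w
    proof -
      have uw: "(u, w) \<in> A" "(w, v) \<in> A" "w \<noteq> v" using rope(2) w arc_irrefl by auto
      then have "(w, v) \<in> join_arcs r" using w by (simp add: r)
      then show "(w, v) \<in> R" using le_R[OF \<open>r \<in> d\<close>] by blast
      have "(u, w) \<notin> insert (ends r) (meet_arcs r)" using uw w by (simp add: r)
      then show "(u, w) \<notin> R" using le_insert[OF \<open>r \<in> d\<close>] by blast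
    qed
    moreover have "w \<in> N \<or> w \<in> U \<longleftrightarrow> (u, w) \<in> A \<and> (w, v) \<in> A" for w
      using rope(2) by blast
    ultimately have "{w. (u, w) \<in> R \<and> (w, v) \<in> A} = N" "{w. (u, w) \<in> A \<and> (w, v) \<in> R} = U"
      using biclosed_subset[OF R] by blast+
    then show ?thesis by (simp add: r)
  qed
  have ends_descent: "ends r \<in> descents R" if r: "r \<in> d" for r
  proof -
    let ?K = "insert (join_arcs r - {ends r}) (join_arcs ` (d - {r}))"
    let ?R' = "join_closure ?K"
    have K: "biclosed S" if "S \<in> ?K" for S
      using that biclosed_K biclosed_join_arcs_Diff_ends[OF ropes[OF r]] by blast
    have "?R' \<subseteq> meet_arcs r"
      using r noncrossing join_arcs_subset_meet_arcs_ends[OF ropes[OF r]]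
      by (intro join_closure_least biclosed_meet_arcs[OF ropes[OF r]]) blast
    then have "ends r \<notin> ?R'" using ends_notin_meet_arcs ropes[OF r] by blast
    moreover have "?R' \<subseteq> R"
      using r le_R by (intro join_closure_least R) blast
    moreover have "ends r \<in> R" using le_R[OF r] ends_mem_join_arcs[OF ropes[OF r]] by blast
    ultimately obtain e where e: "e \<in> descents R" "e \<notin> ?R'"
      using ex_descent[OF R biclosed_join_closure[OF K], of ?K] by blast
    obtain r' where r': "r' \<in> d" "e \<in> join_arcs r'"
      using descent_mem_joinand[OF biclosed_K R R_eq e(1)] by blast
    have "S \<subseteq> ?R'" if "S \<in> ?K" for S using that K by (intro join_closure_upper)
    then have "e = ends r" using r' e(2) by blast
    then show ?thesis using e(1) by simp
  qed
  show descents: "descents R = ends ` d"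
  proof
    show "descents R \<subseteq> ends ` d"
    proof
      fix e assume e: "e \<in> descents R"
      obtain r where r: "r \<in> d" "e \<in> join_arcs r"
        using descent_mem_joinand[OF biclosed_K R R_eq e] by blast
      then have "e = ends r"
        using descent_mem_join_arcs_eq[OF R e ends_descent[OF r(1)]] rope_eq by simp
      with r(1) show "e \<in> ends ` d" by blast
    qed
  qed (use ends_descent in auto)
  show "descent_rope R ` descents R = d" unfolding descents using rope_eq by force
qed

end

section \<open>The isomorphism of complexes\<close>

lemma image_map_sum_Plus: "map_sum f g ` (X <+> Y) = f ` X <+> g ` Y"
  by (auto simp: Plus_def image_Un image_image)

lemma bij_betw_map_sum:
  assumes "bij_betw f X X'" "bij_betw g Y Y'"
  shows "bij_betw (map_sum f g) (X <+> Y) (X' <+> Y')"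
proof -
  have "inj_on (map_sum f g) (X <+> Y)"
    using assms by (intro inj_onI) (auto simp: bij_betw_def dest: inj_onD)
  then show ?thesis
    using assms by (simp add: bij_betw_def image_map_sum_Plus)
qed

context skeletal_dag
begin

abbreviation P :: "'a rel gorder" where "P \<equiv> acyclic_reorientation_poset D"

abbreviation complement :: "'a rel \<Rightarrow> 'a rel" where "complement R \<equiv> A - R"

lemma le_P [simp]: "R \<sqsubseteq>\<^bsub>P\<^esub> S \<longleftrightarrow> R \<subseteq> S"
  by (simp add: acyclic_reorientation_poset_def)

lemma carrier_P [simp]: "carrier P = Collect biclosed"
  by (rule carrier_acyclic_reorientation_poset)

lemma partial_order_P: "partial_order P"
  by unfold_locales (auto simp: acyclic_reorientation_poset_def)

lemma complement_complement: "biclosed R \<Longrightarrow> complement (complement R) = R"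
  by (auto dest: biclosed_subset)

lemma complement_subset_iff:
  "\<lbrakk>biclosed R; biclosed S\<rbrakk> \<Longrightarrow> complement S \<subseteq> complement R \<longleftrightarrow> R \<subseteq> S"
  using biclosed_subset[of R] by blast

lemma least_Upper_characterization:
  assumes "K \<subseteq> carrier P"
  shows "least P R (Upper P K) \<longleftrightarrow>
    biclosed R \<and> (\<forall>S\<in>K. S \<subseteq> R) \<and> (\<forall>T. biclosed T \<and> (\<forall>S\<in>K. S \<subseteq> T) \<longrightarrow> R \<subseteq> T)"
proof -
  have "Upper P K = {T. biclosed T \<and> (\<forall>S\<in>K. S \<subseteq> T)}"
    using assms unfolding Upper_def carrier_P le_P by blast
  then show ?thesis unfolding least_def carrier_P le_P by blast
qed

lemma least_Upper_iff:
  assumes "K \<subseteq> carrier P"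
  shows "least P R (Upper P K) \<longleftrightarrow> R = join_closure K"
proof -
  have K: "biclosed S" if "S \<in> K" for S using assms that by auto
  have "biclosed (join_closure K)" using K by (rule biclosed_join_closure)
  moreover have "S \<subseteq> join_closure K" if "S \<in> K" for S
    using that K by (intro join_closure_upper)
  moreover have "join_closure K \<subseteq> T" if "biclosed T" "\<forall>S\<in>K. S \<subseteq> T" for T
    using that by (intro join_closure_least) auto
  ultimately have "least P (join_closure K) (Upper P K)"
    using K by (auto simp: least_def Upper_def)
  then show ?thesis
    using partial_order.least_unique[OF partial_order_P] by blast
qed

lemma greatest_Lower_iff:
  assumes "K \<subseteq> carrier P"
  shows "greatest P R (Lower P K) \<longleftrightarrow> biclosed R \<and> complement R = join_closure (complement ` K)"
proof -
  have K: "biclosed S" if "S \<in> K" for S using assms that by auto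
  have "Lower P K = {T. biclosed T \<and> (\<forall>S\<in>K. T \<subseteq> S)}"
    unfolding Lower_def carrier_P le_P using K by blast
  then have "greatest P R (Lower P K) \<longleftrightarrow>
      biclosed R \<and> (\<forall>S\<in>K. R \<subseteq> S) \<and> (\<forall>T. biclosed T \<and> (\<forall>S\<in>K. T \<subseteq> S) \<longrightarrow> T \<subseteq> R)"
    unfolding greatest_def carrier_P le_P by blast
  also have "\<dots> \<longleftrightarrow> biclosed R \<and> (\<forall>S\<in>complement ` K. S \<subseteq> complement R) \<and>
      (\<forall>T. biclosed T \<and> (\<forall>S\<in>complement ` K. S \<subseteq> T) \<longrightarrow> complement R \<subseteq> T)"
    (is "_ \<and> ?low \<and> ?great \<longleftrightarrow> _ \<and> ?up \<and> ?least")
  proof (intro conj_cong refl)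
    assume R: "biclosed R"
    show "?low \<longleftrightarrow> ?up" by (simp add: complement_subset_iff R K)
    show "?great \<longleftrightarrow> ?least"
    proof (intro iffI allI impI)
      fix T assume great: ?great and T: "biclosed T \<and> (\<forall>S\<in>complement ` K. S \<subseteq> T)"
      have "complement T \<subseteq> S" if "S \<in> K" for S
      proof -
        have "complement S \<subseteq> T" using T that by simp
        then show ?thesis by blast
      qed
      moreover have "biclosed (complement T)" using T biclosed_Diff by blast
      ultimately have "complement T \<subseteq> R" using great by simp
      then show "complement R \<subseteq> T" by blast
    next
      fix T assume least: ?least and T: "biclosed T \<and> (\<forall>S\<in>K. T \<subseteq> S)"
      have "S \<subseteq> complement T" if "S \<in> complement ` K" for S
        using T that by blast
      moreover have "biclosed (complement T)" using T biclosed_Diff by blast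
      ultimately have "complement R \<subseteq> complement T" using least by simp
      then show "T \<subseteq> R" using T R by (simp add: complement_subset_iff)
    qed
  qed
  also have "\<dots> \<longleftrightarrow> biclosed R \<and> least P (complement R) (Upper P (complement ` K))"
  proof -
    have "complement ` K \<subseteq> carrier P" unfolding carrier_P using K biclosed_Diff by blast
    from least_Upper_characterization[OF this, of "complement R"] show ?thesis
      using biclosed_Diff[of R] by argo
  qed
  also have "\<dots> \<longleftrightarrow> biclosed R \<and> complement R = join_closure (complement ` K)"
    using K biclosed_Diff by (subst least_Upper_iff) auto
  finally show ?thesis .
qed

lemma least_inv_Upper_iff:
  assumes "K \<subseteq> carrier P"
  shows "least (inv_gorder P) R (Upper (inv_gorder P) K) \<longleftrightarrow>
    biclosed R \<and> complement R = join_closure (complement ` K)"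
  unfolding Upper_dual least_dual using assms by (rule greatest_Lower_iff)

lemma canonical_joins_P: "canonical_joins P canonical_joinands"
proof -
  interpret partial_order P by (rule partial_order_P)
  show ?thesis
  proof unfold_locales
    fix K assume K: "K \<subseteq> carrier P"
    then show "\<exists>R. least P R (Upper P K)" by (simp add: least_Upper_iff)
    show "join_refines P (canonical_joinands R) K" if "R \<in> carrier P" "least P R (Upper P K)" for R
    proof -
      have "biclosed S" if "S \<in> K" for S using K that by auto
      then show ?thesis
        using that canonical_joinands_refine[of K R] least_Upper_iff[OF K]
        unfolding join_refines_def le_P carrier_P by blast
    qed
  next
    fix R assume R: "R \<in> carrier P"
    show joinands: "canonical_joinands R \<subseteq> carrier P"
      using R biclosed_canonical_joinands by auto
    show "least P R (Upper P (canonical_joinands R))"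
      using R join_closure_canonical_joinands least_Upper_iff[OF joinands] by simp
    show "S = T" if "S \<in> canonical_joinands R" "T \<in> canonical_joinands R" "S \<sqsubseteq>\<^bsub>P\<^esub> T" for S T
      using R canonical_joinands_antichain that by simp
  qed
qed

lemma canonical_joins_inv_P:
  "canonical_joins (inv_gorder P) (\<lambda>R. complement ` canonical_joinands (complement R))"
proof -
  interpret partial_order "inv_gorder P" by (rule partial_order.dual_order[OF partial_order_P])
  show ?thesis
  proof unfold_locales
    fix K assume "K \<subseteq> carrier (inv_gorder P)"
    then have K: "K \<subseteq> carrier P" by simp
    then have cK: "biclosed S" if "S \<in> complement ` K" for S
      using that biclosed_Diff by auto
    let ?R = "complement (join_closure (complement ` K))"
    have "biclosed (join_closure (complement ` K))" using cK by (rule biclosed_join_closure)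
    then have "biclosed ?R" "complement ?R = join_closure (complement ` K)"
      by (auto simp: complement_complement biclosed_Diff)
    then show "\<exists>R. least (inv_gorder P) R (Upper (inv_gorder P) K)"
      using least_inv_Upper_iff[OF K] by blast
    show "join_refines (inv_gorder P) (complement ` canonical_joinands (complement R)) K"
      if R: "R \<in> carrier (inv_gorder P)" "least (inv_gorder P) R (Upper (inv_gorder P) K)" for R
    proof -
      have "complement R = join_closure (complement ` K)" "biclosed (complement R)"
        using R(2) least_inv_Upper_iff[OF K] biclosed_Diff by blast+
      note refine = canonical_joinands_refine[OF cK \<open>biclosed (complement R)\<close> this(1)]
      show ?thesis
        unfolding join_refines_def
      proof
        fix T' assume "T' \<in> complement ` canonical_joinands (complement R)"
        then obtain T where T: "T \<in> canonical_joinands (complement R)" "T' = complement T" by blast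
        then obtain S where S: "S \<in> K" "T \<subseteq> complement S" using refine by blast
        then have "S \<subseteq> A" using K biclosed_subset by auto
        then have "S \<subseteq> T'" using S(2) T(2) by blast
        with S(1) show "\<exists>S\<in>K. T' \<sqsubseteq>\<^bsub>inv_gorder P\<^esub> S" by auto
      qed
    qed
  next
    fix R assume "R \<in> carrier (inv_gorder P)"
    then have R: "biclosed R" "biclosed (complement R)" by (simp_all add: biclosed_Diff)
    have joinands: "biclosed S" if "S \<in> canonical_joinands (complement R)" for S
      using R(2) that by (rule biclosed_canonical_joinands)
    then have "complement ` canonical_joinands (complement R) \<subseteq> carrier P"
      unfolding carrier_P using biclosed_Diff by blast
    then show "complement ` canonical_joinands (complement R) \<subseteq> carrier (inv_gorder P)"
      by simp
    note least_iff = least_inv_Upper_iff[OF \<open>complement ` canonical_joinands (complement R) \<subseteq> carrier P\<close>]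
    have "complement ` complement ` canonical_joinands (complement R) = canonical_joinands (complement R)"
      using joinands complement_complement by (force simp: image_image)
    then show "least (inv_gorder P) R
        (Upper (inv_gorder P) (complement ` canonical_joinands (complement R)))"
      unfolding least_iff using R join_closure_canonical_joinands by simp
    show "S = T" if ST_mem: "S \<in> complement ` canonical_joinands (complement R)"
      "T \<in> complement ` canonical_joinands (complement R)" "S \<sqsubseteq>\<^bsub>inv_gorder P\<^esub> T" for S T
    proof -
      obtain S' T' where ST: "S = complement S'" "S' \<in> canonical_joinands (complement R)"
        "T = complement T'" "T' \<in> canonical_joinands (complement R)"
        using ST_mem by blast
      then have "S' \<subseteq> T'" using that(3) joinands biclosed_subset by auto
      then show ?thesis using canonical_joinands_antichain[OF R(2) ST(2,4)] ST(1,3) by simp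
    qed
  qed
qed

interpretation joins: canonical_joins P canonical_joinands
  by (rule canonical_joins_P)

interpretation meets: canonical_joins "inv_gorder P" "\<lambda>R. complement ` canonical_joinands (complement R)"
  by (rule canonical_joins_inv_P)

lemma canonical_join_representation_exists_iff:
  "(\<exists>R \<in> carrier P. canonical_join_representation P R J) \<longleftrightarrow>
    (\<exists>d. noncrossing_rope_diagram D d \<and> J = join_arcs ` d)"
proof
  assume "\<exists>R \<in> carrier P. canonical_join_representation P R J"
  then obtain R where "biclosed R" "J = canonical_joinands R"
    using joins.canonical_join_representation_iff by auto
  then show "\<exists>d. noncrossing_rope_diagram D d \<and> J = join_arcs ` d"
    using noncrossing_descent_ropes unfolding canonical_joinands_def by blast
next
  assume "\<exists>d. noncrossing_rope_diagram D d \<and> J = join_arcs ` d"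
  then obtain d where d: "noncrossing_rope_diagram D d" "J = join_arcs ` d" by blast
  let ?R = "join_closure J"
  have "biclosed ?R"
    using d biclosed_join_arcs unfolding noncrossing_rope_diagram_def
    by (intro biclosed_join_closure) blast
  moreover have "canonical_joinands ?R = J"
    using descents_join_closure(2)[OF d(1)] by (simp add: canonical_joinands_def d(2))
  ultimately show "\<exists>R \<in> carrier P. canonical_join_representation P R J"
    using joins.canonical_join_representation_iff[of ?R] by auto
qed

lemma noncrossing_rope_diagram_flip:
  assumes "noncrossing_rope_diagram D d"
  shows "noncrossing_rope_diagram D (flip ` d)"
  unfolding noncrossing_rope_diagram_def
proof (intro conjI ballI impI)
  show "flip ` d \<subseteq> ropes D"
    using assms flip_mem_ropes_iff unfolding noncrossing_rope_diagram_def by blast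
  fix s s' assume s: "s \<in> flip ` d" "s' \<in> flip ` d" "s \<noteq> s'"
  then obtain r r' where r: "r \<in> d" "s = flip r" "r' \<in> d" "s' = flip r'" by blast
  with s(3) have "r \<noteq> r'" by auto
  with assms r(1,3) have "\<not> crossing r r'" by (simp add: noncrossing_rope_diagram_def)
  then show "\<not> crossing s s'" by (simp only: r(2,4) crossing_flip not_False_eq_True)
qed

lemma complement_join_arcs: "complement (join_arcs r) = meet_arcs (flip r)"
  by (simp add: meet_arcs_conv_join_arcs)

lemma canonical_meet_representation_exists_iff:
  "(\<exists>R \<in> carrier P. canonical_meet_representation P R M) \<longleftrightarrow>
    (\<exists>d. noncrossing_rope_diagram D d \<and> M = meet_arcs ` d)"
proof -
  have "(\<exists>R \<in> carrier P. canonical_meet_representation P R M) \<longleftrightarrow>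
      (\<exists>R. biclosed R \<and> M = complement ` canonical_joinands (complement R))"
    using meets.canonical_join_representation_iff by (auto simp: canonical_meet_representation_def)
  also have "\<dots> \<longleftrightarrow> (\<exists>R. biclosed R \<and> M = complement ` canonical_joinands R)"
    using biclosed_Diff complement_complement by metis
  also have "\<dots> \<longleftrightarrow> (\<exists>J. (\<exists>R \<in> carrier P. canonical_join_representation P R J) \<and> M = complement ` J)"
    using joins.canonical_join_representation_iff by auto
  also have "\<dots> \<longleftrightarrow> (\<exists>d. noncrossing_rope_diagram D d \<and> M = meet_arcs ` flip ` d)"
  proof -
    have "complement ` join_arcs ` d = meet_arcs ` flip ` d" for d
      by (simp only: image_image complement_join_arcs)
    then show ?thesis unfolding canonical_join_representation_exists_iff by metis
  qed
  also have "\<dots> \<longleftrightarrow> (\<exists>d. noncrossing_rope_diagram D d \<and> M = meet_arcs ` d)"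
  proof -
    have "flip ` flip ` d = d" for d by (simp add: image_image)
    then show ?thesis using noncrossing_rope_diagram_flip by metis
  qed
  finally show ?thesis .
qed

lemma canonical_joinands_join_arcs:
  assumes "r \<in> ropes D"
  shows "descent_rope (join_arcs r) ` descents (join_arcs r) = {r}"
    and "canonical_joinands (join_arcs r) = {join_arcs r}"
proof -
  have "biclosed (join_arcs r)" using assms by (rule biclosed_join_arcs)
  then have "join_closure {join_arcs r} = join_arcs r"
    by (intro subset_antisym join_closure_least join_closure_upper) auto
  moreover have "noncrossing_rope_diagram D {r}"
    using assms by (simp add: noncrossing_rope_diagram_def)
  ultimately show "descent_rope (join_arcs r) ` descents (join_arcs r) = {r}"
    using descents_join_closure(2)[of "{r}"] by simp
  then show "canonical_joinands (join_arcs r) = {join_arcs r}"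
    by (simp add: canonical_joinands_def)
qed

lemma bij_betw_join_arcs: "bij_betw join_arcs (ropes D) {R. join_irreducible P R}"
proof (rule bij_betw_imageI)
  show "inj_on join_arcs (ropes D)"
    using canonical_joinands_join_arcs(1) by (intro inj_onI) (metis singleton_inject)
  show "join_arcs ` ropes D = {R. join_irreducible P R}"
  proof (intro equalityI subsetI)
    fix R assume "R \<in> join_arcs ` ropes D"
    then show "R \<in> {R. join_irreducible P R}"
      using canonical_joinands_join_arcs(2) biclosed_join_arcs by (auto simp: joins.join_irreducible_iff simp del: join_arcs.simps)
  next
    fix R assume "R \<in> {R. join_irreducible P R}"
    then have "biclosed R" "R \<in> canonical_joinands R" by (auto simp: joins.join_irreducible_iff)
    then obtain e where "e \<in> descents R" "R = join_arcs (descent_rope R e)"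
      unfolding canonical_joinands_def image_image by (elim imageE)
    then show "R \<in> join_arcs ` ropes D"
      using descent_rope_in_ropes[OF \<open>biclosed R\<close>] by (metis imageI)
  qed
qed

lemma meet_irreducible_iff: "meet_irreducible P R \<longleftrightarrow> R \<subseteq> A \<and> join_irreducible P (complement R)"
proof -
  have "biclosed R \<longleftrightarrow> R \<subseteq> A \<and> biclosed (complement R)"
    using biclosed_Diff biclosed_subset by (metis double_diff subset_refl)
  moreover have "R \<in> complement ` canonical_joinands (complement R) \<longleftrightarrow>
      complement R \<in> canonical_joinands (complement R)" if "biclosed R"
  proof
    assume "R \<in> complement ` canonical_joinands (complement R)"
    then obtain S where S: "S \<in> canonical_joinands (complement R)" "R = complement S" by blast
    then have "complement R = S"
      using biclosed_canonical_joinands biclosed_Diff[OF that] complement_complement by metis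
    with S(1) show "complement R \<in> canonical_joinands (complement R)" by simp
  next
    assume "complement R \<in> canonical_joinands (complement R)"
    then show "R \<in> complement ` canonical_joinands (complement R)"
      using complement_complement[OF that] by (metis imageI)
  qed
  moreover have "meet_irreducible P R \<longleftrightarrow>
      biclosed R \<and> R \<in> complement ` canonical_joinands (complement R)"
    unfolding meet_irreducible_def meets.join_irreducible_iff by simp
  ultimately show ?thesis
    unfolding joins.join_irreducible_iff carrier_P mem_Collect_eq by blast
qed

lemma bij_betw_meet_arcs: "bij_betw meet_arcs (ropes D) {R. meet_irreducible P R}"
proof -
  have flip: "bij_betw flip (ropes D) (ropes D)"
  proof (rule bij_betw_byWitness[where f' = flip])
    show "flip ` ropes D \<subseteq> ropes D" by (rule image_subsetI) (simp only: flip_mem_ropes_iff)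
    then show "flip ` ropes D \<subseteq> ropes D" .
  qed simp_all
  have complement: "bij_betw complement {R. join_irreducible P R} {R. meet_irreducible P R}"
    by (rule bij_betw_byWitness[where f' = complement])
      (auto simp: meet_irreducible_iff joins.join_irreducible_iff complement_complement
        dest: biclosed_subset)
  have "meet_arcs = complement \<circ> (join_arcs \<circ> flip)"
    by (rule ext) (simp add: meet_arcs_conv_join_arcs)
  then show ?thesis
    using bij_betw_trans[OF bij_betw_trans[OF flip bij_betw_join_arcs] complement] by simp
qed

lemma sup_le_inf_iff:
  assumes "J \<subseteq> carrier P" "M \<subseteq> carrier P"
  shows "\<Squnion>\<^bsub>P\<^esub> J \<sqsubseteq>\<^bsub>P\<^esub> \<Sqinter>\<^bsub>P\<^esub> M \<longleftrightarrow> (\<forall>S\<in>J. \<forall>T\<in>M. S \<subseteq> T)"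
proof -
  have inf: "\<Sqinter>\<^bsub>P\<^esub> M = \<Squnion>\<^bsub>inv_gorder P\<^esub> M" by (rule sup_dual[symmetric])
  have "\<Sqinter>\<^bsub>P\<^esub> M \<in> carrier P" using meets.sup_closed[of M] assms(2) by (simp add: inf)
  then have "\<Squnion>\<^bsub>P\<^esub> J \<sqsubseteq>\<^bsub>P\<^esub> \<Sqinter>\<^bsub>P\<^esub> M \<longleftrightarrow> (\<forall>S\<in>J. S \<subseteq> \<Sqinter>\<^bsub>P\<^esub> M)"
    using joins.sup_le_iff[OF assms(1)] by simp
  moreover have "S \<subseteq> \<Sqinter>\<^bsub>P\<^esub> M \<longleftrightarrow> (\<forall>T\<in>M. S \<subseteq> T)" if "S \<in> J" for S
    using meets.sup_le_iff[of M S] assms that by (auto simp: inf)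
  ultimately show ?thesis by simp
qed

lemma canonical_complex_conv_ropes:
  "snd (canonical_complex P) = {join_arcs ` dj <+> meet_arcs ` dm | dj dm. rope_bidiagram D (dj, dm)}"
proof -
  have key: "\<Squnion>\<^bsub>P\<^esub> (join_arcs ` dj) \<sqsubseteq>\<^bsub>P\<^esub> \<Sqinter>\<^bsub>P\<^esub> (meet_arcs ` dm) \<longleftrightarrow> (\<forall>r\<in>dj. \<forall>r'\<in>dm. rope_entails D r r')"
    if "noncrossing_rope_diagram D dj" "noncrossing_rope_diagram D dm" for dj dm
  proof -
    have "join_arcs ` dj \<subseteq> carrier P" "meet_arcs ` dm \<subseteq> carrier P"
      using that biclosed_join_arcs biclosed_meet_arcs
      unfolding noncrossing_rope_diagram_def carrier_P by blast+
    then show ?thesis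
      by (simp only: sup_le_inf_iff ball_simps rope_entails_iff)
  qed
  show ?thesis (is "_ = ?F")
  proof (intro equalityI subsetI)
    fix F assume "F \<in> snd (canonical_complex P)"
    then obtain dj dm where d: "noncrossing_rope_diagram D dj" "noncrossing_rope_diagram D dm"
      "\<Squnion>\<^bsub>P\<^esub> (join_arcs ` dj) \<sqsubseteq>\<^bsub>P\<^esub> \<Sqinter>\<^bsub>P\<^esub> (meet_arcs ` dm)" "F = join_arcs ` dj <+> meet_arcs ` dm"
      unfolding canonical_complex_def snd_conv canonical_join_representation_exists_iff
        canonical_meet_representation_exists_iff by blast
    then have "rope_bidiagram D (dj, dm)" using key by (simp add: rope_bidiagram_def)
    with d(4) show "F \<in> ?F" by blast
  next
    fix F assume "F \<in> ?F"
    then obtain dj dm where d: "rope_bidiagram D (dj, dm)" "F = join_arcs ` dj <+> meet_arcs ` dm"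
      by blast
    then have "noncrossing_rope_diagram D dj" "noncrossing_rope_diagram D dm"
      "\<Squnion>\<^bsub>P\<^esub> (join_arcs ` dj) \<sqsubseteq>\<^bsub>P\<^esub> \<Sqinter>\<^bsub>P\<^esub> (meet_arcs ` dm)"
      using key by (simp_all add: rope_bidiagram_def)
    with d(2) show "F \<in> snd (canonical_complex P)"
      unfolding canonical_complex_def snd_conv canonical_join_representation_exists_iff
        canonical_meet_representation_exists_iff by blast
  qed
qed

lemma complex_isomorphic_rope_bidiagram_complex:
  "complex_isomorphic (canonical_complex P) (rope_bidiagram_complex D)"
proof (rule complex_isomorphic_if_inverse_bij)
  let ?g = "map_sum join_arcs meet_arcs"
  show "bij_betw ?g (fst (rope_bidiagram_complex D)) (fst (canonical_complex P))"
    unfolding rope_bidiagram_complex_def canonical_complex_def fst_conv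
    using bij_betw_join_arcs bij_betw_meet_arcs by (rule bij_betw_map_sum)
  have "(`) ?g ` {dj <+> dm | dj dm. rope_bidiagram D (dj, dm)} =
      {?g ` (dj <+> dm) | dj dm. rope_bidiagram D (dj, dm)}" by blast
  then show "(`) ?g ` snd (rope_bidiagram_complex D) = snd (canonical_complex P)"
    by (simp only: canonical_complex_conv_ropes image_map_sum_Plus rope_bidiagram_complex_def snd_conv)
  show "F \<subseteq> fst (rope_bidiagram_complex D)" if face: "F \<in> snd (rope_bidiagram_complex D)" for F
  proof -
    obtain dj dm where "rope_bidiagram D (dj, dm)" and F: "F = dj <+> dm"
      using face unfolding rope_bidiagram_complex_def snd_conv by blast
    then have "dj \<subseteq> ropes D" "dm \<subseteq> ropes D"
      by (simp_all only: rope_bidiagram_def noncrossing_rope_diagram_def prod.case)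
    with F show ?thesis by (auto simp only: rope_bidiagram_complex_def fst_conv)
  qed
qed

end

theorem corollary34:
  fixes D :: "'a pair_pre_digraph"
  assumes "pair_digraph D"
    and "acyclic (parcs D)"
    and "skeletal D"
  shows "complex_isomorphic
    (canonical_complex (acyclic_reorientation_poset D))
    (rope_bidiagram_complex D)"
proof -
  interpret skeletal_dag D using assms by (rule skeletal_dag.intro)
  show ?thesis by (rule complex_isomorphic_rope_bidiagram_complex)
qed

end
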